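(* Let $n\ge1$ and let $G$ be a subgroup of $\{\pm1\}^n$, acting by algebra automorphisms on $S=\mathbb{C}[x_1,\dots,x_n,y_1,\dots,y_n]$ by $(\epsilon_1,\dots,\epsilon_n).x_i=\epsilon_ix_i$, $(\epsilon_1,\dots,\epsilon_n).y_i=\epsilon_iy_i$, and on the Weyl algebra $A=A_n(\mathbb{C})$ by $(\epsilon_1,\dots,\epsilon_n).p_i=\epsilon_ip_i$, $(\epsilon_1,\dots,\epsilon_n).q_i=\epsilon_iq_i$. Then: - $\dim_{\mathbb{C}}HP_0(S^G)=0$ if there exists $i\in\{1,\dots,n\}$ such that $G\subseteq\{\pm1\}^{i-1}\times\{1\}\times\{\pm1\}^{n-i}$, and $\dim_{\mathbb{C}}HP_0(S^G)=1$ otherwise; - $\dim_{\mathbb{C}}HH_0(A^G)=0$ if $(-1,\dots,-1)\notin G$, and $\dim_{\mathbb{C}}HH_0(A^G)=1$ otherwise.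
   Context: $S$ carries the standard Poisson bracket $\{x_i,y_j\}=\delta_{ij}$, $\{x_i,x_j\}=\{y_i,y_j\}=0$, for which $G$ acts by Poisson automorphisms. $A_n(\mathbb{C})$ is the Weyl algebra generated by $p_1,\dots,p_n,q_1,\dots,q_n$ with $[p_i,q_j]=\delta_{ij}$, $[p_i,p_j]=[q_i,q_j]=0$. $S^G$, $A^G$ are the invariant algebras. $HP_0(S^G)=S^G/\{S^G,S^G\}$ and $HH_0(A^G)=A^G/[A^G,A^G]$, where $\{S^G,S^G\}$ and $[A^G,A^G]$ denote the linear spans of the brackets, respectively commutators. *)

theory Defs
  imports
    "HOL-Library.Poly_Mapping"
    "HOL-Algebra.Product_Groups"
    "HOL-Algebra.Sym_Groups"
    "Jordan_Normal_Form.VS_Connect"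
begin

hide_const (open) Multiset.mult

section \<open>Monoid algebras over the complex numbers\<close>

text \<open>
  The type \<open>'m \<Rightarrow>\<^sub>0 complex\<close> is the monoid algebra of the (additively written) monoid \<open>'m\<close>.
  With exponent vectors for \<open>'m\<close> it is a polynomial ring, with words it is a free algebra.
\<close>

definition scale :: "complex \<Rightarrow> ('m::monoid_add \<Rightarrow>\<^sub>0 complex) \<Rightarrow> ('m \<Rightarrow>\<^sub>0 complex)" where
  "scale c f = Poly_Mapping.single 0 c * f"

definition lin_ext ::
    "('m \<Rightarrow> ('k::monoid_add \<Rightarrow>\<^sub>0 complex)) \<Rightarrow> ('m \<Rightarrow>\<^sub>0 complex) \<Rightarrow> ('k \<Rightarrow>\<^sub>0 complex)" where
  "lin_ext F f = (\<Sum>m\<in>Poly_Mapping.keys f. scale (Poly_Mapping.lookup f m) (F m))"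

lemma pm_induct [case_names zero single add]:
  fixes f :: "'m \<Rightarrow>\<^sub>0 'c::comm_monoid_add"
  assumes "P 0" "\<And>m c. P (Poly_Mapping.single m c)" "\<And>f g. P f \<Longrightarrow> P g \<Longrightarrow> P (f + g)"
  shows "P f"
proof -
  have "P (\<Sum>m\<in>A. Poly_Mapping.single m (Poly_Mapping.lookup f m))" if "finite A" for A
    using that by (induction A) (auto intro: assms)
  moreover have "(\<Sum>m\<in>Poly_Mapping.keys f. Poly_Mapping.single m (Poly_Mapping.lookup f m)) = f"
    by (rule poly_mapping_eqI)
      (auto simp: lookup_sum lookup_single when_def in_keys_iff sum.delta)
  ultimately show ?thesis
    by (metis finite_keys)
qed

lemma scale_single [simp]: "scale c (Poly_Mapping.single m d) = Poly_Mapping.single m (c * d)"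
  by (simp add: scale_def mult_single)

lemma scale_add_right: "scale c (f + g) = scale c f + scale c g"
  by (simp add: scale_def algebra_simps)

lemma scale_add_left: "scale (c + d) f = scale c f + scale d f"
  by (simp add: scale_def single_add algebra_simps)

lemma scale_scale [simp]: "scale c (scale d f) = scale (c * d) f"
  by (simp add: scale_def mult.assoc[symmetric] mult_single)

lemma scale_one [simp]: "scale 1 f = f"
  by (simp add: scale_def)

lemma scale_mult_left: "scale c f * g = scale c (f * g)"
  by (simp add: scale_def mult.assoc)

lemma scale_mult_right: "f * scale c g = scale c (f * g)"
proof -
  have "f * Poly_Mapping.single 0 c = Poly_Mapping.single 0 c * f"
    by (induction f rule: pm_induct) (simp_all add: mult_single algebra_simps)
  then show ?thesis by (metis mult.assoc scale_def)
qed

lemma scale_zero_left [simp]: "scale 0 f = 0"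
  by (simp add: scale_def)

global_interpretation pm: vector_space "scale :: complex \<Rightarrow> ('m::monoid_add \<Rightarrow>\<^sub>0 complex) \<Rightarrow> _"
  by unfold_locales (simp_all add: scale_add_right scale_add_left)

lemma lin_ext_superset:
  assumes "finite A" "Poly_Mapping.keys f \<subseteq> A"
  shows "lin_ext F f = (\<Sum>m\<in>A. scale (Poly_Mapping.lookup f m) (F m))"
  unfolding lin_ext_def
  by (rule sum.mono_neutral_left) (use assms in \<open>auto simp: in_keys_iff\<close>)

lemma lin_ext_zero [simp]: "lin_ext F 0 = 0"
  by (simp add: lin_ext_def)

lemma lin_ext_add: "lin_ext F (f + g) = lin_ext F f + lin_ext F g"
proof -
  let ?A = "Poly_Mapping.keys f \<union> Poly_Mapping.keys g"
  have "lin_ext F h = (\<Sum>m\<in>?A. scale (Poly_Mapping.lookup h m) (F m))"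
    if "h \<in> {f, g, f + g}" for h
    by (rule lin_ext_superset)
      (use that Poly_Mapping.keys_add[of f g] in auto)
  then show ?thesis
    by (simp add: lookup_add scale_add_left sum.distrib)
qed

lemma lin_ext_single [simp]: "lin_ext F (Poly_Mapping.single m c) = scale c (F m)"
proof -
  have "lin_ext F (Poly_Mapping.single m c) =
      (\<Sum>k\<in>{m}. scale (Poly_Mapping.lookup (Poly_Mapping.single m c) k) (F k))"
    by (rule lin_ext_superset) auto
  then show ?thesis by simp
qed

lemma lin_ext_scale: "lin_ext F (scale c f) = scale c (lin_ext F f)"
  by (induction f rule: pm_induct) (simp_all add: lin_ext_add scale_add_right)

lemma lin_ext_uminus: "lin_ext F (- f) = - lin_ext F f"
  using lin_ext_add[of F f "- f"] by (simp add: minus_unique)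

lemma lin_ext_diff: "lin_ext F (f - g) = lin_ext F f - lin_ext F g"
  using lin_ext_add[of F f "- g"] by (simp add: lin_ext_uminus)

lemma lin_ext_mult:
  assumes "\<And>m k. F (m + k) = F m * F k"
  shows "lin_ext F (f * g) = lin_ext F f * lin_ext F g"
proof (induction f rule: pm_induct)
  case (single m c)
  show ?case
    by (induction g rule: pm_induct)
      (simp_all add: lin_ext_add mult_single assms scale_mult_left scale_mult_right algebra_simps)
qed (simp_all add: lin_ext_add algebra_simps)


section \<open>The Poisson algebra\<close>

text \<open>
  The finite type \<open>'n\<close> plays the role of the index set \<open>{1, \<dots>, n}\<close>. In \<open>'n + 'n\<close>, the
  element \<open>Inl i\<close> stands for \<open>x\<^sub>i\<close> (later \<open>p\<^sub>i\<close>) and \<open>Inr i\<close> for \<open>y\<^sub>i\<close> (later \<open>q\<^sub>i\<close>).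
\<close>

type_synonym 'n poisson_alg = "(('n + 'n) \<Rightarrow>\<^sub>0 nat) \<Rightarrow>\<^sub>0 complex"

definition pvar :: "'n + 'n \<Rightarrow> 'n poisson_alg" where
  "pvar v = Poly_Mapping.single (Poly_Mapping.single v 1) 1"

abbreviation S_x :: "'n \<Rightarrow> 'n poisson_alg" where "S_x i \<equiv> pvar (Inl i)"
abbreviation S_y :: "'n \<Rightarrow> 'n poisson_alg" where "S_y i \<equiv> pvar (Inr i)"

definition partial :: "'n + 'n \<Rightarrow> 'n poisson_alg \<Rightarrow> 'n poisson_alg" where
  "partial v = lin_ext (\<lambda>m. Poly_Mapping.single (m - Poly_Mapping.single v 1)
                              (of_nat (Poly_Mapping.lookup m v)))"

definition poisson :: "'n::finite poisson_alg \<Rightarrow> 'n poisson_alg \<Rightarrow> 'n poisson_alg" where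
  "poisson f g = (\<Sum>i\<in>UNIV. partial (Inl i) f * partial (Inr i) g
                          - partial (Inr i) f * partial (Inl i) g)"

lemma partial_add: "partial v (f + g) = partial v f + partial v g"
  by (simp add: partial_def lin_ext_add)

lemma partial_zero [simp]: "partial v 0 = 0"
  by (simp add: partial_def)

lemma partial_single:
  "partial v (Poly_Mapping.single m c) =
     Poly_Mapping.single (m - Poly_Mapping.single v 1) (c * of_nat (Poly_Mapping.lookup m v))"
  by (simp add: partial_def)

lemma partial_scale: "partial v (scale c f) = scale c (partial v f)"
  by (simp add: partial_def lin_ext_scale)

lemma exponent_minus_plus:
  fixes m k :: "'v \<Rightarrow>\<^sub>0 nat"
  assumes "Poly_Mapping.lookup m v \<noteq> 0"
  shows "m - Poly_Mapping.single v 1 + k = m + k - Poly_Mapping.single v 1"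
  by (rule poly_mapping_eqI)
    (use assms in \<open>auto simp: lookup_add lookup_minus lookup_single when_def\<close>)

lemma partial_mult: "partial v (f * g) = partial v f * g + f * partial v g"
proof (induction f rule: pm_induct)
  case (single m c)
  show ?case
  proof (induction g rule: pm_induct)
    case (single k d)
    have "Poly_Mapping.single (m - Poly_Mapping.single v 1 + k) (c * of_nat (Poly_Mapping.lookup m v) * d)
        = Poly_Mapping.single (m + k - Poly_Mapping.single v 1) (c * of_nat (Poly_Mapping.lookup m v) * d)"
      using exponent_minus_plus[of m v k]
      by (cases "Poly_Mapping.lookup m v = 0") simp_all
    moreover
    have "Poly_Mapping.single (m + (k - Poly_Mapping.single v 1)) (c * (d * of_nat (Poly_Mapping.lookup k v)))
        = Poly_Mapping.single (m + k - Poly_Mapping.single v 1) (c * (d * of_nat (Poly_Mapping.lookup k v)))"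
      using exponent_minus_plus[of k v m]
      by (cases "Poly_Mapping.lookup k v = 0") (simp_all add: add.commute)
    ultimately show ?case
      by (simp add: mult_single partial_single lookup_add algebra_simps flip: single_add)
  qed (simp_all add: partial_add algebra_simps)
qed (simp_all add: partial_add algebra_simps)

lemma partial_pvar: "partial v (pvar u) = (if u = v then 1 else 0)"
  by (simp add: pvar_def partial_single lookup_single)

lemma partial_commute: "partial u (partial v f) = partial v (partial u f)"
proof (induction f rule: pm_induct)
  case (single m c)
  show ?case
    by (cases "u = v")
      (simp_all add: partial_single lookup_minus lookup_single diff_diff_eq add.commute mult_ac)
qed (simp_all add: partial_add)

lemma poisson_add_left: "poisson (f + g) h = poisson f h + poisson g h"
  by (simp add: poisson_def partial_add algebra_simps flip: sum.distrib)

lemma poisson_scale_left: "poisson (scale c f) h = scale c (poisson f h)"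
  by (simp add: poisson_def partial_scale scale_mult_left pm.scale_sum_right pm.scale_right_diff_distrib)

lemma poisson_antisym: "poisson f g = - poisson g f"
  by (simp add: poisson_def mult.commute flip: sum_negf)

lemma poisson_leibniz: "poisson (f * g) h = f * poisson g h + poisson f h * g"
  by (simp add: poisson_def partial_mult sum_distrib_left sum_distrib_right algebra_simps
      flip: sum.distrib)

lemma poisson_x_y: "poisson (S_x i) (S_y j) = (if i = j then 1 else 0)"
proof -
  have "poisson (S_x i) (S_y j) = (\<Sum>k\<in>UNIV. if k = i then if i = j then 1 else 0 else 0)"
    unfolding poisson_def by (rule sum.cong) (auto simp: partial_pvar)
  then show ?thesis
    by (simp only: sum.delta finite UNIV_I if_True)
qed

lemma poisson_x_x: "poisson (S_x i) (S_x j) = 0"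
  and poisson_y_y: "poisson (S_y i) (S_y j) = 0"
  by (simp_all add: poisson_def partial_pvar)


section \<open>The Weyl algebra\<close>

text \<open>Words form the free monoid, so \<open>'v list \<Rightarrow>\<^sub>0 complex\<close> is the free algebra on \<open>'v\<close>.\<close>

instantiation list :: (type) monoid_add
begin
definition zero_list :: "'a list" where "0 = []"
definition plus_list :: "'a list \<Rightarrow> 'a list \<Rightarrow> 'a list" where "xs + ys = xs @ ys"
instance by standard (simp_all add: zero_list_def plus_list_def)
end

type_synonym 'v free_alg = "'v list \<Rightarrow>\<^sub>0 complex"

definition fvar :: "'v \<Rightarrow> 'v free_alg" where
  "fvar v = Poly_Mapping.single [v] 1"

definition commutator :: "'a::ring \<Rightarrow> 'a \<Rightarrow> 'a" where
  "commutator a b = a * b - b * a"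

definition weyl_relations :: "('n + 'n) free_alg set" where
  "weyl_relations =
     {commutator (fvar (Inl i)) (fvar (Inr j)) - (if i = j then 1 else 0) | i j. True}
   \<union> {commutator (fvar (Inl i)) (fvar (Inl j)) | i j. True}
   \<union> {commutator (fvar (Inr i)) (fvar (Inr j)) | i j. True}"

inductive_set weyl_ideal :: "('n + 'n) free_alg set" where
  zero: "0 \<in> weyl_ideal"
| add: "a \<in> weyl_ideal \<Longrightarrow> b \<in> weyl_ideal \<Longrightarrow> a + b \<in> weyl_ideal"
| gen: "r \<in> weyl_relations \<Longrightarrow> a * r * b \<in> weyl_ideal"

lemma weyl_ideal_mult_left: "a \<in> weyl_ideal \<Longrightarrow> c * a \<in> weyl_ideal"
proof (induction rule: weyl_ideal.induct)
  case (gen r a b)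
  then show ?case using weyl_ideal.gen[of r "c * a" b] by (simp add: mult.assoc)
qed (auto simp: algebra_simps intro: weyl_ideal.intros)

lemma weyl_ideal_mult_right: "a \<in> weyl_ideal \<Longrightarrow> a * c \<in> weyl_ideal"
proof (induction rule: weyl_ideal.induct)
  case (gen r a b)
  then show ?case using weyl_ideal.gen[of r a "b * c"] by (simp add: mult.assoc)
qed (auto simp: algebra_simps intro: weyl_ideal.intros)

lemma weyl_ideal_uminus: "a \<in> weyl_ideal \<Longrightarrow> - a \<in> weyl_ideal"
  using weyl_ideal_mult_left[of a "- 1"] by simp

lemma weyl_ideal_diff: "a \<in> weyl_ideal \<Longrightarrow> b \<in> weyl_ideal \<Longrightarrow> a - b \<in> weyl_ideal"
  using weyl_ideal.add[OF _ weyl_ideal_uminus] by fastforce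

lemma weyl_ideal_scale: "a \<in> weyl_ideal \<Longrightarrow> scale c a \<in> weyl_ideal"
  by (simp add: scale_def weyl_ideal_mult_left)

lemma weyl_ideal_relation: "r \<in> weyl_relations \<Longrightarrow> r \<in> weyl_ideal"
  using weyl_ideal.gen[of r 1 1] by simp

definition weyl_rel :: "('n + 'n) free_alg \<Rightarrow> ('n + 'n) free_alg \<Rightarrow> bool" where
  "weyl_rel a b \<longleftrightarrow> a - b \<in> weyl_ideal"

lemma weyl_rel_equivp: "equivp weyl_rel"
proof (rule equivpI)
  show "reflp weyl_rel"
    by (simp add: reflp_def weyl_rel_def weyl_ideal.zero)
  show "symp weyl_rel"
    unfolding symp_def weyl_rel_def using weyl_ideal_uminus by fastforce
  show "transp weyl_rel"
    unfolding transp_def weyl_rel_def using weyl_ideal.add by fastforce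
qed

text \<open>
  The relations are consistent: \<open>p\<^sub>i\<close> and \<open>q\<^sub>i\<close> act on polynomials by differentiation with
  respect to \<open>x\<^sub>i\<close> and by multiplication with \<open>x\<^sub>i\<close>, respectively.
\<close>

fun gen_op :: "'n + 'n \<Rightarrow> 'n poisson_alg \<Rightarrow> 'n poisson_alg" where
  "gen_op (Inl i) g = partial (Inl i) g"
| "gen_op (Inr i) g = pvar (Inl i) * g"

definition diff_op :: "('n + 'n) free_alg \<Rightarrow> 'n poisson_alg \<Rightarrow> 'n poisson_alg" where
  "diff_op a g = lin_ext (\<lambda>w. foldr gen_op w g) a"

lemma gen_op_add: "gen_op v (f + g) = gen_op v f + gen_op v g"
  by (cases v) (simp_all add: partial_add algebra_simps)

lemma gen_op_scale: "gen_op v (scale c f) = scale c (gen_op v f)"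
  by (cases v) (simp_all add: partial_scale scale_mult_right)

lemma word_op_add: "foldr gen_op w (f + g) = foldr gen_op w f + foldr gen_op w g"
  by (induction w) (simp_all add: gen_op_add)

lemma word_op_scale: "foldr gen_op w (scale c f) = scale c (foldr gen_op w f)"
  by (induction w) (simp_all add: gen_op_scale)

lemma word_op_zero: "foldr gen_op w 0 = 0"
  using word_op_scale[of w 0 0] by simp

lemma diff_op_mult: "diff_op (a * b) g = diff_op a (diff_op b g)"
proof (induction a rule: pm_induct)
  case (single w c)
  show ?case
    by (induction b rule: pm_induct)
      (simp_all add: diff_op_def lin_ext_add mult_single plus_list_def word_op_add word_op_scale
        word_op_zero scale_add_right distrib_left)
qed (simp_all add: diff_op_def lin_ext_add distrib_right)

lemma diff_op_zero_right: "diff_op a 0 = 0"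
  by (simp add: diff_op_def word_op_zero lin_ext_def)

lemma diff_op_fvar: "diff_op (fvar v) g = gen_op v g"
  by (simp add: diff_op_def fvar_def)

lemma diff_op_one: "diff_op 1 g = g"
  by (simp add: diff_op_def zero_list_def flip: single_one)

lemma diff_op_diff: "diff_op (a - b) g = diff_op a g - diff_op b g"
  by (simp add: diff_op_def lin_ext_diff)

lemma diff_op_commutator:
  "diff_op (commutator (fvar u) (fvar v)) g = gen_op u (gen_op v g) - gen_op v (gen_op u g)"
  by (simp add: commutator_def diff_op_diff diff_op_mult diff_op_fvar)

lemma diff_op_zero_left: "diff_op 0 g = 0"
  by (simp add: diff_op_def)

lemma diff_op_relation:
  assumes "r \<in> weyl_relations"
  shows "diff_op r g = 0"
proof -
  have pq: "diff_op (commutator (fvar (Inl i)) (fvar (Inr j)) - (if i = j then 1 else 0)) g = 0"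
    for i j
    by (simp add: diff_op_diff diff_op_commutator diff_op_one diff_op_zero_left partial_mult
        partial_pvar)
  have pp: "diff_op (commutator (fvar (Inl i)) (fvar (Inl j))) g = 0" for i j
    using partial_commute[of "Inl i" "Inl j" g] by (simp add: diff_op_commutator)
  have qq: "diff_op (commutator (fvar (Inr i)) (fvar (Inr j))) g = 0" for i j
    by (simp add: diff_op_commutator mult.left_commute)
  show ?thesis
    using assms pq pp qq unfolding weyl_relations_def by blast
qed

lemma diff_op_ideal: "a \<in> weyl_ideal \<Longrightarrow> diff_op a g = 0"
  by (induction rule: weyl_ideal.induct)
    (simp_all add: diff_op_mult diff_op_relation diff_op_zero_right,
     simp_all add: diff_op_def lin_ext_add)

lemma one_notin_weyl_ideal: "1 \<notin> weyl_ideal"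
  using diff_op_ideal[of 1 1] by (auto simp: diff_op_one)

quotient_type 'n weyl = "('n + 'n) free_alg" / weyl_rel
  by (rule weyl_rel_equivp)

instantiation weyl :: (type) ring_1
begin

lift_definition zero_weyl :: "'a weyl" is 0 .
lift_definition one_weyl :: "'a weyl" is 1 .

lift_definition plus_weyl :: "'a weyl \<Rightarrow> 'a weyl \<Rightarrow> 'a weyl" is "(+)"
  unfolding weyl_rel_def add_diff_add by (rule weyl_ideal.add)

lift_definition uminus_weyl :: "'a weyl \<Rightarrow> 'a weyl" is uminus
  unfolding weyl_rel_def minus_diff_minus by (rule weyl_ideal_uminus)

lift_definition minus_weyl :: "'a weyl \<Rightarrow> 'a weyl \<Rightarrow> 'a weyl" is "(-)"
proof -
  fix a b c d :: "('a + 'a) free_alg"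
  assume "weyl_rel a b" "weyl_rel c d"
  then have "(a - b) - (c - d) \<in> weyl_ideal"
    by (simp add: weyl_rel_def weyl_ideal_diff)
  then show "weyl_rel (a - c) (b - d)"
    by (simp add: weyl_rel_def algebra_simps)
qed

lift_definition times_weyl :: "'a weyl \<Rightarrow> 'a weyl \<Rightarrow> 'a weyl" is "(*)"
proof -
  fix a b c d :: "('a + 'a) free_alg"
  assume "weyl_rel a b" "weyl_rel c d"
  then have "(a - b) * c + b * (c - d) \<in> weyl_ideal"
    by (simp add: weyl_rel_def weyl_ideal.add weyl_ideal_mult_left weyl_ideal_mult_right)
  then show "weyl_rel (a * c) (b * d)"
    by (simp add: weyl_rel_def algebra_simps)
qed

instance
proof
  show "(0 :: 'a weyl) \<noteq> 1"
    by transfer (use one_notin_weyl_ideal weyl_ideal_uminus in \<open>fastforce simp: weyl_rel_def\<close>)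
qed (transfer; simp add: weyl_rel_def algebra_simps weyl_ideal.zero)+

end

lift_definition weyl_scale :: "complex \<Rightarrow> 'n weyl \<Rightarrow> 'n weyl" is scale
  unfolding weyl_rel_def
  by (simp add: weyl_ideal_scale flip: pm.scale_right_diff_distrib)

global_interpretation weyl: vector_space "weyl_scale :: complex \<Rightarrow> 'n weyl \<Rightarrow> _"
  by unfold_locales
    (transfer; simp add: weyl_rel_def scale_add_left scale_add_right weyl_ideal.zero)+

lemma weyl_scale_mult_left: "weyl_scale c a * b = weyl_scale c (a * b)"
  by transfer (simp add: weyl_rel_def scale_mult_left weyl_ideal.zero)

lemma weyl_scale_mult_right: "a * weyl_scale c b = weyl_scale c (a * b)"
  by transfer (simp add: weyl_rel_def scale_mult_right weyl_ideal.zero)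

lift_definition weyl_var :: "'n + 'n \<Rightarrow> 'n weyl" is fvar .

abbreviation A_p :: "'n \<Rightarrow> 'n weyl" where "A_p i \<equiv> weyl_var (Inl i)"
abbreviation A_q :: "'n \<Rightarrow> 'n weyl" where "A_q i \<equiv> weyl_var (Inr i)"

lemma weyl_p_q: "commutator (A_p i) (A_q j) = (if i = j then 1 else 0)"
proof (cases "i = j")
  case True
  have "commutator (A_p i) (A_q i) = 1"
    unfolding commutator_def
  proof (transfer fixing: i)
    show "weyl_rel (fvar (Inl i) * fvar (Inr i) - fvar (Inr i) * fvar (Inl i)) 1"
      unfolding weyl_rel_def
      by (rule weyl_ideal_relation) (force simp: weyl_relations_def commutator_def)
  qed
  with True show ?thesis by simp
next
  case False
  have "commutator (A_p i) (A_q j) = 0"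
    unfolding commutator_def
  proof (transfer fixing: i j)
    show "weyl_rel (fvar (Inl i) * fvar (Inr j) - fvar (Inr j) * fvar (Inl i)) 0"
      unfolding weyl_rel_def
      by (rule weyl_ideal_relation) (use False in \<open>force simp: weyl_relations_def commutator_def\<close>)
  qed
  with False show ?thesis by simp
qed

lemma weyl_p_p: "commutator (A_p i) (A_p j) = 0"
  unfolding commutator_def
proof (transfer fixing: i j)
  show "weyl_rel (fvar (Inl i) * fvar (Inl j) - fvar (Inl j) * fvar (Inl i)) 0"
    unfolding weyl_rel_def
    by (rule weyl_ideal_relation) (force simp: weyl_relations_def commutator_def)
qed

lemma weyl_q_q: "commutator (A_q i) (A_q j) = 0"
  unfolding commutator_def
proof (transfer fixing: i j)
  show "weyl_rel (fvar (Inr i) * fvar (Inr j) - fvar (Inr j) * fvar (Inr i)) 0"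
    unfolding weyl_rel_def
    by (rule weyl_ideal_relation) (force simp: weyl_relations_def commutator_def)
qed


section \<open>Group actions\<close>

definition sign_vectors :: "('n \<Rightarrow> int) monoid" where
  "sign_vectors = product_group UNIV (\<lambda>_. sign_img)"

lemma sign_vectors_group: "group sign_vectors"
  by (simp add: sign_vectors_def sign_img_is_group)

lemma sign_vectors_iff: "e \<in> carrier sign_vectors \<longleftrightarrow> (\<forall>i. e i = 1 \<or> e i = - 1)"
  by (auto simp: sign_vectors_def sign_img_def PiE_def)

fun var_sign :: "('n \<Rightarrow> int) \<Rightarrow> 'n + 'n \<Rightarrow> complex" where
  "var_sign e (Inl i) = of_int (e i)"
| "var_sign e (Inr i) = of_int (e i)"

definition S_act :: "('n::finite \<Rightarrow> int) \<Rightarrow> 'n poisson_alg \<Rightarrow> 'n poisson_alg" where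
  "S_act e = lin_ext (\<lambda>m. \<Prod>v\<in>UNIV. scale (var_sign e v) (pvar v) ^ Poly_Mapping.lookup m v)"

definition free_act :: "('n \<Rightarrow> int) \<Rightarrow> ('n + 'n) free_alg \<Rightarrow> ('n + 'n) free_alg" where
  "free_act e = lin_ext (\<lambda>w. prod_list (map (\<lambda>v. scale (var_sign e v) (fvar v)) w))"

text \<open>
  For \<open>e\<close> outside \<open>{1, -1}\<^sup>n\<close> the relations are not preserved and the following map depends on the
  chosen representatives; for sign vectors it is the induced automorphism, see \<open>weyl_act_abs\<close>.
\<close>

definition weyl_act :: "('n \<Rightarrow> int) \<Rightarrow> 'n weyl \<Rightarrow> 'n weyl" where
  "weyl_act e a = abs_weyl (free_act e (rep_weyl a))"

lemma S_act_add: "S_act e (f + g) = S_act e f + S_act e g"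
  by (simp add: S_act_def lin_ext_add)

lemma S_act_zero: "S_act e 0 = 0"
  by (simp add: S_act_def)

lemma S_act_diff: "S_act e (f - g) = S_act e f - S_act e g"
  by (simp add: S_act_def lin_ext_diff)

lemma S_act_scale: "S_act e (scale c f) = scale c (S_act e f)"
  by (simp add: S_act_def lin_ext_scale)

lemma S_act_mult: "S_act e (f * g) = S_act e f * S_act e g"
  unfolding S_act_def
  by (rule lin_ext_mult) (simp add: lookup_add power_add prod.distrib)

lemma S_act_one: "S_act e 1 = 1"
proof -
  have "S_act e (Poly_Mapping.single 0 1) = 1"
    unfolding S_act_def lin_ext_single by simp
  then show ?thesis by simp
qed

lemma S_act_pvar: "S_act e (pvar v) = scale (var_sign e v) (pvar v)"
proof -
  have "(\<Prod>u\<in>UNIV. scale (var_sign e u) (pvar u) ^ Poly_Mapping.lookup (Poly_Mapping.single v 1) u)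
      = (\<Prod>u\<in>UNIV. if u = v then scale (var_sign e u) (pvar u) else 1)"
    by (rule prod.cong) (auto simp: lookup_single)
  then show ?thesis
    by (simp add: S_act_def pvar_def)
qed

lemma pvar_monomial:
  fixes m :: "('n::finite + 'n) \<Rightarrow>\<^sub>0 nat"
  shows "(\<Prod>v\<in>UNIV. pvar v ^ Poly_Mapping.lookup m v) = Poly_Mapping.single m 1"
proof -
  have pow: "pvar v ^ k = Poly_Mapping.single (Poly_Mapping.single v k) 1" for v :: "'n + 'n" and k
    by (induction k) (simp_all add: pvar_def mult_single flip: single_add)
  have "(\<Prod>v\<in>A. pvar v ^ Poly_Mapping.lookup m v) =
      Poly_Mapping.single (\<Sum>v\<in>A. Poly_Mapping.single v (Poly_Mapping.lookup m v)) 1"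
    if "finite A" for A
    using that by (induction A) (simp_all add: pow mult_single)
  moreover have "(\<Sum>v\<in>UNIV. Poly_Mapping.single v (Poly_Mapping.lookup m v)) = m"
    by (rule poly_mapping_eqI) (simp add: lookup_sum lookup_single when_def sum.delta)
  ultimately show ?thesis by simp
qed

lemma S_act_single:
  "S_act e (Poly_Mapping.single m c) =
     scale (\<Prod>v\<in>UNIV. var_sign e v ^ Poly_Mapping.lookup m v) (Poly_Mapping.single m c)"
proof -
  have pow: "scale a f ^ k = scale (a ^ k) (f ^ k)" for a and f :: "'a poisson_alg" and k
    by (induction k) (simp_all add: scale_mult_left scale_mult_right mult.commute)
  have "(\<Prod>v\<in>A. scale (a v) (f v)) = scale (\<Prod>v\<in>A. a v) (\<Prod>v\<in>A. f v)"
    if "finite A" for A and a and f :: "'a + 'a \<Rightarrow> 'a poisson_alg"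
    using that by (induction A) (simp_all add: scale_mult_left scale_mult_right mult.commute)
  then show ?thesis
    by (simp add: S_act_def pow pvar_monomial del: scale_single)
      (simp add: mult.commute)
qed

lemma S_act_partial:
  assumes "e \<in> carrier sign_vectors"
  shows "S_act e (partial v f) = scale (var_sign e v) (partial v (S_act e f))"
proof (induction f rule: pm_induct)
  case (single m c)
  have sq: "var_sign e v = 1 \<or> var_sign e v = - 1"
    using assms by (cases v) (force simp: sign_vectors_iff)+
  show ?case
  proof (cases "Poly_Mapping.lookup m v = 0")
    case True
    then show ?thesis by (simp add: S_act_single partial_single S_act_zero)
  next
    case False
    let ?k = "m - Poly_Mapping.single v 1"
    have "m = ?k + Poly_Mapping.single v 1"
      by (rule poly_mapping_eqI)
        (use False in \<open>auto simp: lookup_add lookup_minus lookup_single when_def\<close>)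
    then have "(\<Prod>u\<in>UNIV. var_sign e u ^ Poly_Mapping.lookup m u)
        = (\<Prod>u\<in>UNIV. var_sign e u ^ Poly_Mapping.lookup (?k + Poly_Mapping.single v 1) u)"
      by simp
    also have "\<dots> = (\<Prod>u\<in>UNIV. var_sign e u ^ Poly_Mapping.lookup ?k u)
        * (\<Prod>u\<in>UNIV. if u = v then var_sign e u else 1)"
      unfolding lookup_add power_add prod.distrib
      by (intro arg_cong2[where f = "(*)"] refl prod.cong) (auto simp: lookup_single)
    also have "\<dots> = (\<Prod>u\<in>UNIV. var_sign e u ^ Poly_Mapping.lookup ?k u) * var_sign e v"
      by simp
    finally have m: "(\<Prod>u\<in>UNIV. var_sign e u ^ Poly_Mapping.lookup m u) = \<dots>" .
    show ?thesis
      using sq m by (elim disjE) (simp_all add: S_act_single partial_single mult_ac)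
  qed
qed (simp_all add: partial_add S_act_add scale_add_right S_act_zero)

lemma S_act_poisson:
  assumes "e \<in> carrier sign_vectors"
  shows "S_act e (poisson f g) = poisson (S_act e f) (S_act e g)"
proof -
  have sq: "of_int (e i) * of_int (e i) = (1::complex)" for i
    using assms by (auto simp: sign_vectors_iff dest: spec[of _ i])
  have "S_act e (\<Sum>i\<in>A. h i) = (\<Sum>i\<in>A. S_act e (h i))" if "finite A" for A :: "'a set" and h
    using that by (induction A) (simp_all add: S_act_zero S_act_add)
  then show ?thesis
    by (simp add: poisson_def S_act_diff S_act_mult S_act_partial[OF assms]
        scale_mult_left scale_mult_right sq)
qed

lemma free_act_add: "free_act e (a + b) = free_act e a + free_act e b"
  by (simp add: free_act_def lin_ext_add)

lemma free_act_diff: "free_act e (a - b) = free_act e a - free_act e b"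
  by (simp add: free_act_def lin_ext_diff)

lemma free_act_zero: "free_act e 0 = 0"
  by (simp add: free_act_def)

lemma free_act_scale: "free_act e (scale c a) = scale c (free_act e a)"
  by (simp add: free_act_def lin_ext_scale)

lemma free_act_mult: "free_act e (a * b) = free_act e a * free_act e b"
  unfolding free_act_def
  by (rule lin_ext_mult) (simp add: plus_list_def)

lemma free_act_one: "free_act e 1 = 1"
  by (simp add: free_act_def zero_list_def flip: single_one)

lemma free_act_fvar: "free_act e (fvar v) = scale (var_sign e v) (fvar v)"
  by (simp add: free_act_def fvar_def)

lemma free_act_commutator:
  "free_act e (commutator (fvar u) (fvar v)) =
     scale (var_sign e u * var_sign e v) (commutator (fvar u) (fvar v))"
  by (simp add: commutator_def free_act_diff free_act_mult free_act_fvar scale_mult_left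
      scale_mult_right pm.scale_right_diff_distrib mult.commute)

lemma free_act_relation:
  assumes "e \<in> carrier sign_vectors" "r \<in> weyl_relations"
  shows "free_act e r \<in> weyl_ideal"
proof -
  have sq: "of_int (e i) * of_int (e i) = (1::complex)" for i
    using assms(1) by (auto simp: sign_vectors_iff dest: spec[of _ i])
  have "free_act e (commutator (fvar (Inl i)) (fvar (Inr j)) - (if i = j then 1 else 0)) =
      scale (of_int (e i) * of_int (e j))
        (commutator (fvar (Inl i)) (fvar (Inr j)) - (if i = j then 1 else 0))" for i j
    using sq by (simp add: free_act_diff free_act_commutator free_act_one free_act_zero)
  then have "\<exists>c. free_act e r = scale c r"
    using assms(2) free_act_commutator unfolding weyl_relations_def by blast
  then show ?thesis
    using weyl_ideal_scale[OF weyl_ideal_relation[OF assms(2)]] by auto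
qed

lemma free_act_ideal:
  assumes "e \<in> carrier sign_vectors" "a \<in> weyl_ideal"
  shows "free_act e a \<in> weyl_ideal"
  using assms(2)
  by (induction rule: weyl_ideal.induct)
    (simp_all add: free_act_zero free_act_add free_act_mult weyl_ideal.zero weyl_ideal.add
      weyl_ideal_mult_left weyl_ideal_mult_right free_act_relation[OF assms(1)])

lemma weyl_act_abs:
  assumes "e \<in> carrier sign_vectors"
  shows "weyl_act e (abs_weyl a) = abs_weyl (free_act e a)"
proof -
  have "weyl_rel (rep_weyl (abs_weyl a)) a"
    by (meson Quotient3_rep_abs Quotient3_weyl equivp_reflp weyl_rel_equivp)
  then show ?thesis
    unfolding weyl_act_def weyl.abs_eq_iff weyl_rel_def
    by (metis assms free_act_diff free_act_ideal)
qed

lemma weyl_act_add: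
  assumes "e \<in> carrier sign_vectors"
  shows "weyl_act e (a + b) = weyl_act e a + weyl_act e b"
  by (induction a, induction b)
    (simp add: weyl_act_abs[OF assms] plus_weyl.abs_eq free_act_add)

lemma weyl_act_scale:
  assumes "e \<in> carrier sign_vectors"
  shows "weyl_act e (weyl_scale c a) = weyl_scale c (weyl_act e a)"
  by (induction a) (simp add: weyl_act_abs[OF assms] weyl_scale.abs_eq free_act_scale)

lemma weyl_act_mult:
  assumes "e \<in> carrier sign_vectors"
  shows "weyl_act e (a * b) = weyl_act e a * weyl_act e b"
  by (induction a, induction b)
    (simp add: weyl_act_abs[OF assms] times_weyl.abs_eq free_act_mult)

lemma weyl_act_one: "e \<in> carrier sign_vectors \<Longrightarrow> weyl_act e 1 = 1"
  by (simp add: one_weyl.abs_eq weyl_act_abs free_act_one)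

lemma weyl_act_var:
  "e \<in> carrier sign_vectors \<Longrightarrow> weyl_act e (weyl_var v) = weyl_scale (var_sign e v) (weyl_var v)"
  by (simp add: weyl_var.abs_eq weyl_act_abs free_act_fvar weyl_scale.abs_eq)

definition invariants :: "('g \<Rightarrow> 'a \<Rightarrow> 'a) \<Rightarrow> 'g set \<Rightarrow> 'a set" where
  "invariants act G = {a. \<forall>g\<in>G. act g a = a}"


section \<open>Quotient spaces, \<open>HP\<^sub>0\<close> and \<open>HH\<^sub>0\<close>\<close>

text \<open>
  The elements of \<open>W/V\<close> are the cosets \<open>w + V\<close> with \<open>w \<in> W\<close>. The ring multiplication and unit of
  the record play no role for a vector space.
\<close>

definition quotient_space ::
    "(complex \<Rightarrow> 'a \<Rightarrow> 'a) \<Rightarrow> 'a set \<Rightarrow> 'a set \<Rightarrow> (complex, 'a::ab_group_add set) module" where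
  "quotient_space scl W V =
     \<lparr>carrier = (\<lambda>w. (+) w ` V) ` W,
      mult = undefined, one = undefined,
      zero = V,
      add = (\<lambda>X Y. {x + y | x y. x \<in> X \<and> y \<in> Y}),
      smult = (\<lambda>c X. {scl c x + v | x v. x \<in> X \<and> v \<in> V})\<rparr>"

lemma quotient_space_vectorspace:
  fixes scl :: "complex \<Rightarrow> 'a::ab_group_add \<Rightarrow> 'a"
  assumes "vector_space scl"
    and W: "Modules.module.subspace scl W" and V: "Modules.module.subspace scl V"
  shows "vectorspace class_ring (quotient_space scl W V)"
proof -
  interpret vector_space scl by fact
  note cl = subspace_0[OF W] subspace_add[OF W] subspace_neg[OF W] subspace_scale[OF W]
  let ?c = "\<lambda>w. (+) w ` V" and ?Q = "quotient_space scl W V"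
  have car: "carrier ?Q = ?c ` W" and zer: "zero ?Q = V"
    by (simp_all add: quotient_space_def)
  have zero: "?c 0 = V" by simp
  have add: "add ?Q (?c w) (?c w') = ?c (w + w')" for w w'
  proof (intro equalityI subsetI)
    fix z assume "z \<in> add ?Q (?c w) (?c w')"
    then obtain u v where "u \<in> V" "v \<in> V" "z = (w + u) + (w' + v)"
      by (auto simp: quotient_space_def)
    then show "z \<in> ?c (w + w')"
      by (intro image_eqI[of _ _ "u + v"]) (simp_all add: subspace_add[OF V])
  next
    fix z assume "z \<in> ?c (w + w')"
    then obtain v where v: "v \<in> V" "z = (w + 0) + (w' + v)"
      by (auto simp: add.assoc)
    have "w + 0 \<in> ?c w" "w' + v \<in> ?c w'"
      using v(1) subspace_0[OF V] by blast+
    then show "z \<in> add ?Q (?c w) (?c w')"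
      unfolding v(2) quotient_space_def by auto
  qed
  have smult: "smult ?Q k (?c w) = ?c (scl k w)" for k w
  proof (intro equalityI subsetI)
    fix z assume "z \<in> smult ?Q k (?c w)"
    then obtain u v where "u \<in> V" "v \<in> V" "z = scl k (w + u) + v"
      by (auto simp: quotient_space_def)
    then show "z \<in> ?c (scl k w)"
      by (intro image_eqI[of _ _ "scl k u + v"])
        (simp_all add: subspace_add[OF V] subspace_scale[OF V] scale_right_distrib)
  next
    fix z assume "z \<in> ?c (scl k w)"
    then obtain v where v: "v \<in> V" "z = scl k (w + 0) + v"
      by auto
    have "w + 0 \<in> ?c w"
      using subspace_0[OF V] by blast
    then show "z \<in> smult ?Q k (?c w)"
      unfolding v(2) quotient_space_def using v(1) by auto
  qed
  have zer': "zero ?Q = ?c 0" using zer zero by simp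
  have "abelian_group ?Q"
  proof (rule abelian_groupI)
    fix x y assume "x \<in> carrier ?Q" "y \<in> carrier ?Q"
    then show "x \<oplus>\<^bsub>?Q\<^esub> y \<in> carrier ?Q" "x \<oplus>\<^bsub>?Q\<^esub> y = y \<oplus>\<^bsub>?Q\<^esub> x"
      unfolding car using cl by (auto simp: add add.commute)
  next
    show "\<zero>\<^bsub>?Q\<^esub> \<in> carrier ?Q" unfolding car zer' using cl by blast
  next
    fix x y z assume "x \<in> carrier ?Q" "y \<in> carrier ?Q" "z \<in> carrier ?Q"
    then show "x \<oplus>\<^bsub>?Q\<^esub> y \<oplus>\<^bsub>?Q\<^esub> z = x \<oplus>\<^bsub>?Q\<^esub> (y \<oplus>\<^bsub>?Q\<^esub> z)"
      unfolding car by (elim imageE) (simp only: add add.assoc)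
  next
    fix x assume x: "x \<in> carrier ?Q"
    then obtain w where w: "w \<in> W" "x = ?c w" unfolding car by blast
    show "\<zero>\<^bsub>?Q\<^esub> \<oplus>\<^bsub>?Q\<^esub> x = x" unfolding zer' w add by simp
    have "?c (- w) \<oplus>\<^bsub>?Q\<^esub> x = \<zero>\<^bsub>?Q\<^esub>" unfolding zer' w add by simp
    then show "\<exists>y\<in>carrier ?Q. y \<oplus>\<^bsub>?Q\<^esub> x = \<zero>\<^bsub>?Q\<^esub>"
      using w(1) cl unfolding car by blast
  qed
  moreover have fld: "field (class_ring :: complex ring)"
    by (rule class_field.field_axioms)
  ultimately have "Module.module class_ring ?Q"
    unfolding Module.module_def Module.module_axioms_def using cl
    by (auto simp: car add smult field.is_ring scale_right_distrib scale_left_distrib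
        intro: fieldE(1))
  then show ?thesis
    using fld by (simp add: vectorspace_def)
qed

definition HP0 :: "('n::finite \<Rightarrow> int) set \<Rightarrow> (complex, 'n poisson_alg set) module" where
  "HP0 G = (let SG = invariants S_act G in
     quotient_space scale SG (pm.span {poisson f g | f g. f \<in> SG \<and> g \<in> SG}))"

definition HH0 :: "('n::finite \<Rightarrow> int) set \<Rightarrow> (complex, 'n weyl set) module" where
  "HH0 G = (let AG = invariants weyl_act G in
     quotient_space weyl_scale AG (weyl.span {commutator a b | a b. a \<in> AG \<and> b \<in> AG}))"

lemma invariants_S_subspace: "pm.subspace (invariants S_act G)"
  by (auto simp: pm.subspace_def invariants_def S_act_add S_act_scale)
    (simp add: S_act_zero)

lemma invariants_weyl_subspace:
  assumes "G \<subseteq> carrier sign_vectors"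
  shows "weyl.subspace (invariants weyl_act G)"
  using assms weyl_act_scale[of _ 0 0]
  by (auto simp: weyl.subspace_def invariants_def weyl_act_add weyl_act_scale subset_iff)

lemma HP0_vectorspace: "vectorspace class_ring (HP0 G)"
  unfolding HP0_def Let_def
  by (intro quotient_space_vectorspace pm.vector_space_axioms invariants_S_subspace pm.subspace_span)

lemma HH0_vectorspace:
  "G \<subseteq> carrier sign_vectors \<Longrightarrow> vectorspace class_ring (HH0 G)"
  unfolding HH0_def Let_def
  by (intro quotient_space_vectorspace weyl.vector_space_axioms invariants_weyl_subspace
      weyl.subspace_span)

text \<open>
  The locale constant \<open>vectorspace.dim\<close> is meaningful only for finite-dimensional spaces.
\<close>

definition has_dim :: "(complex, 'v) module \<Rightarrow> nat \<Rightarrow> bool" where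
  "has_dim V d \<longleftrightarrow> vectorspace.fin_dim class_ring V \<and> vectorspace.dim class_ring V = d"

end

theory Submission
  imports Defs
begin

text \<open>
  Both quotients are spanned by the class of \<open>1\<close>, because the brackets with the squares of the
  variables, which are always invariant, produce every nonconstant monomial. In \<open>S\<^sup>G\<close> the
  constant term of a bracket only involves the linear terms of its arguments; hence \<open>1\<close> is a
  sum of brackets iff some \<open>x\<^sub>i\<close> is invariant. In the Weyl algebra, the constant term \<open>\<tau>\<close> of the
  Weyl symbol satisfies \<open>\<tau>(v a) = - \<tau>(a v)\<close> for every generator \<open>v\<close>. If \<open>-1 \<in> G\<close>, then all invariants
  are even, and \<open>\<tau>\<close> kills their commutators but not \<open>1\<close>. If \<open>-1 \<notin> G\<close>, then some product of an odd
  number of the coordinate characters is trivial on \<open>G\<close>, the corresponding products \<open>P\<close> of the \<open>p\<^sub>i\<close> and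
  \<open>Q\<close> of the \<open>q\<^sub>i\<close> are invariant, and \<open>\<tau>([P, Q]) = 2 \<tau>(P Q) \<noteq> 0\<close>, so \<open>[P, Q]\<close> is a nonzero multiple of \<open>1\<close>
  modulo the commutators with squares, which \<open>\<tau>\<close> kills.
\<close>

section \<open>Dimensions of quotient spaces\<close>

lemma has_dim_quotient_0:
  fixes scl :: "complex \<Rightarrow> 'a::ab_group_add \<Rightarrow> 'a"
  assumes "vector_space scl"
    and W: "Modules.module.subspace scl W" and V: "Modules.module.subspace scl V"
    and "W \<subseteq> V"
  shows "has_dim (quotient_space scl W V) 0"
proof -
  interpret vector_space scl by fact
  let ?Q = "quotient_space scl W V"
  interpret Q: vectorspace class_ring ?Q
    by (rule quotient_space_vectorspace) fact+
  have "(+) w ` V = V" if "w \<in> V" for w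
  proof
    show "(+) w ` V \<subseteq> V"
      using subspace_add[OF V that] by blast
    show "V \<subseteq> (+) w ` V"
    proof
      fix v assume "v \<in> V"
      then have "v - w \<in> V" using that by (rule subspace_diff[OF V])
      then show "v \<in> (+) w ` V" by (rule image_eqI[rotated]) simp
    qed
  qed
  then have "carrier ?Q \<subseteq> {\<zero>\<^bsub>?Q\<^esub>}"
    using \<open>W \<subseteq> V\<close> by (auto simp: quotient_space_def)
  then have gen: "Q.gen_set {\<zero>\<^bsub>?Q\<^esub>}"
    using Q.span_is_subset2[of "{\<zero>\<^bsub>?Q\<^esub>}"] Q.in_own_span[of "{\<zero>\<^bsub>?Q\<^esub>}"] by auto
  then show ?thesis
    unfolding has_dim_def Q.fin_dim_def by (auto intro!: exI[of _ "{\<zero>\<^bsub>?Q\<^esub>}"] Q.dim0I)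
qed

text \<open>The class of \<open>u\<close> is nonzero because \<open>u\<close> lies outside
  \<open>V\<close>, and it generates because every element of \<open>W\<close> is a multiple of
  \<open>u\<close> modulo \<open>V\<close>.\<close>

lemma has_dim_quotient_1:
  fixes scl :: "complex \<Rightarrow> 'a::ab_group_add \<Rightarrow> 'a"
  assumes "vector_space scl"
    and W: "Modules.module.subspace scl W" and V: "Modules.module.subspace scl V"
    and u: "u \<in> W" "u \<notin> V" and span: "\<And>w. w \<in> W \<Longrightarrow> \<exists>c. w - scl c u \<in> V"
  shows "has_dim (quotient_space scl W V) 1"
proof -
  interpret vector_space scl by fact
  let ?Q = "quotient_space scl W V" and ?c = "\<lambda>w. (+) w ` V"
  interpret Q: vectorspace class_ring ?Q
    by (rule quotient_space_vectorspace) fact+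
  have car: "carrier ?Q = ?c ` W" and zer: "\<zero>\<^bsub>?Q\<^esub> = V"
    by (simp_all add: quotient_space_def)
  have smult: "k \<odot>\<^bsub>?Q\<^esub> ?c u = ?c w" if "w - scl k u \<in> V" for k w
  proof (intro equalityI subsetI)
    fix z assume "z \<in> k \<odot>\<^bsub>?Q\<^esub> ?c u"
    then obtain v v' where v: "v \<in> V" "v' \<in> V" "z = scl k (u + v) + v'"
      by (auto simp: quotient_space_def)
    have "scl k v + v' - (w - scl k u) \<in> V"
      using v that by (intro subspace_diff[OF V _ that] subspace_add[OF V] subspace_scale[OF V])
    then show "z \<in> ?c w"
      by (rule image_eqI[rotated]) (simp add: v(3) scale_right_distrib algebra_simps)
  next
    fix z assume "z \<in> ?c w"
    then obtain v where v: "v \<in> V" "z = w + v" by blast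
    define t where "t = w - scl k u + v"
    have t: "z = scl k u + t" by (simp add: t_def v)
    have "t \<in> V"
      unfolding t_def using that v by (intro subspace_add[OF V])
    moreover have "u \<in> ?c u"
      using subspace_0[OF V] by (rule image_eqI[rotated]) simp
    ultimately show "z \<in> k \<odot>\<^bsub>?Q\<^esub> ?c u"
      unfolding t by (auto simp: quotient_space_def)
  qed
  have cu: "?c u \<in> carrier ?Q" using u by (simp add: car)
  have "?c u \<noteq> V"
    using u subspace_0[OF V] by (metis add.right_neutral image_eqI)
  then have "?c u \<noteq> \<zero>\<^bsub>?Q\<^esub>" by (simp only: zer not_False_eq_True)
  moreover have gen: "Q.gen_set {?c u}"
  proof
    show "Q.span {?c u} \<subseteq> carrier ?Q" using cu by (intro Q.span_is_subset2) simp
    show "carrier ?Q \<subseteq> Q.span {?c u}"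
    proof
      fix X assume "X \<in> carrier ?Q"
      then obtain w where "w \<in> W" "X = ?c w" unfolding car by blast
      then obtain k where X: "X = k \<odot>\<^bsub>?Q\<^esub> ?c u"
        using smult span by metis
      show "X \<in> Q.span {?c u}"
        unfolding X using Q.span_is_submodule[of "{?c u}"] Q.in_own_span[of "{?c u}"] cu
        by (auto simp: submodule_def)
    qed
  qed
  ultimately have "Q.dim = 1" using cu by (intro Q.dim1I)
  moreover have "Q.fin_dim"
    unfolding Q.fin_dim_def using cu gen by (intro exI[of _ "{?c u}"]) simp
  ultimately show ?thesis
    unfolding has_dim_def by simp
qed

text \<open>Brackets and commutators produce the wanted monomials and words only up to a nonzero
  scalar, which is divided out here.\<close>

lemma (in vector_space) in_span_if_scaled:
  assumes "scale c a \<in> span V" "c \<noteq> 0"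
  shows "a \<in> span V"
  using span_scale[OF assms(1), of "inverse c"] assms(2) by simp

section \<open>The Poisson algebra\<close>

lemma lookup_scale: "Poly_Mapping.lookup (scale c f) m = c * Poly_Mapping.lookup f m"
  by (induction f rule: pm_induct)
    (simp_all add: scale_add_right lookup_add algebra_simps lookup_single when_def)

lemma subspace_if_monomials:
  assumes "pm.subspace V"
    and "\<And>m. m \<in> Poly_Mapping.keys f \<Longrightarrow> Poly_Mapping.single m 1 \<in> V"
  shows "f \<in> V"
proof -
  have "f = (\<Sum>m\<in>Poly_Mapping.keys f. scale (Poly_Mapping.lookup f m) (Poly_Mapping.single m 1))"
    by (rule poly_mapping_eqI)
      (auto simp: lookup_sum lookup_single when_def in_keys_iff sum.delta)
  also have "\<dots> \<in> V"
    using assms by (intro pm.subspace_sum pm.subspace_scale)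
  finally show ?thesis .
qed

section \<open>Conjugate variables and brackets with squares\<close>

fun dual :: "'n + 'n \<Rightarrow> 'n + 'n" where
  "dual (Inl i) = Inr i"
| "dual (Inr i) = Inl i"

text \<open>The common value of the Poisson bracket and of the commutator of \<open>v\<close> with
  its conjugate \<open>dual v\<close>; it treats both kinds of generators uniformly.\<close>

fun orientation :: "'n + 'n \<Rightarrow> complex" where
  "orientation (Inl i) = 1"
| "orientation (Inr i) = - 1"

lemma dual_dual [simp]: "dual (dual v) = v"
  by (cases v) simp_all

lemma orientation_dual [simp]: "orientation (dual v) = - orientation v"
  by (cases v) simp_all

lemma orientation_neq_0 [simp]: "orientation v \<noteq> 0"
  by (cases v) simp_all

lemma var_sign_dual [simp]: "var_sign e (dual v) = var_sign e v"
  by (cases v) simp_all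

lemma var_sign_square:
  "e \<in> carrier sign_vectors \<Longrightarrow> var_sign e v * var_sign e v = 1"
  by (cases v) (auto simp: sign_vectors_iff simp flip: of_int_mult dest: spec[of _ "projl v"] spec[of _ "projr v"])

lemma poisson_pvar: "poisson (pvar v) g = scale (orientation v) (partial (dual v) g)"
proof (cases v)
  case (Inl i)
  have "poisson (pvar v) g = (\<Sum>k\<in>UNIV. if k = i then partial (Inr i) g else 0)"
    unfolding poisson_def by (rule sum.cong) (auto simp: partial_pvar Inl)
  then show ?thesis by (simp add: Inl)
next
  case (Inr i)
  have "poisson (pvar v) g = (\<Sum>k\<in>UNIV. if k = i then - partial (Inl i) g else 0)"
    unfolding poisson_def by (rule sum.cong) (auto simp: partial_pvar Inr)
  then show ?thesis by (simp add: Inr)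
qed

text \<open>By the Leibniz rule, bracketing with the square of \<open>v\<close> trades one factor
  \<open>dual v\<close> of a monomial for a factor \<open>v\<close>, up to a scalar.\<close>

lemma poisson_pvar_square:
  "poisson (pvar v * pvar v) g = scale (2 * orientation v) (pvar v * partial (dual v) g)"
proof -
  have "poisson (pvar v * pvar v) g = scale (1 + 1) (pvar v * poisson (pvar v) g)"
    unfolding poisson_leibniz scale_add_left by (simp add: mult.commute)
  then show ?thesis by (simp add: poisson_pvar scale_mult_right)
qed

definition exponent_sign :: "('n::finite \<Rightarrow> int) \<Rightarrow> ('n + 'n \<Rightarrow>\<^sub>0 nat) \<Rightarrow> complex" where
  "exponent_sign e m = (\<Prod>v\<in>UNIV. var_sign e v ^ Poly_Mapping.lookup m v)"

lemma exponent_sign_add: "exponent_sign e (m + k) = exponent_sign e m * exponent_sign e k"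
  by (simp add: exponent_sign_def lookup_add power_add prod.distrib)

lemma exponent_sign_single [simp]: "exponent_sign e (Poly_Mapping.single v k) = var_sign e v ^ k"
proof -
  have "exponent_sign e (Poly_Mapping.single v k) = (\<Prod>u\<in>UNIV. if u = v then var_sign e u ^ k else 1)"
    unfolding exponent_sign_def by (rule prod.cong) (auto simp: lookup_single)
  then show ?thesis by simp
qed

lemma lookup_S_act:
  "Poly_Mapping.lookup (S_act e f) m = exponent_sign e m * Poly_Mapping.lookup f m"
  by (induction f rule: pm_induct)
    (auto simp: S_act_zero S_act_add S_act_single lookup_add algebra_simps lookup_single when_def
      exponent_sign_def lookup_scale simp del: scale_single)

text \<open>Sign vectors act diagonally on monomials, so each coefficient is scaled
  separately.\<close>

lemma invariants_S_iff:
  "f \<in> invariants S_act G \<longleftrightarrow> (\<forall>m\<in>Poly_Mapping.keys f. \<forall>e\<in>G. exponent_sign e m = 1)"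
proof -
  have "S_act e f = f \<longleftrightarrow> (\<forall>m\<in>Poly_Mapping.keys f. exponent_sign e m = 1)" for e
  proof
    assume "S_act e f = f"
    then show "\<forall>m\<in>Poly_Mapping.keys f. exponent_sign e m = 1"
      using lookup_S_act[of e f] by (auto simp: in_keys_iff)
  qed (auto intro!: poly_mapping_eqI simp: lookup_S_act in_keys_iff)
  then show ?thesis by (auto simp: invariants_def)
qed

abbreviation S_brackets :: "('n::finite \<Rightarrow> int) set \<Rightarrow> 'n poisson_alg set" where
  "S_brackets G \<equiv> {poisson f g | f g. f \<in> invariants S_act G \<and> g \<in> invariants S_act G}"

lemma of_nat_plus_1_neq_0 [simp]: "of_nat k + 1 \<noteq> (0::complex)"
  using of_nat_neq_0[of k, where ?'a = complex] by (simp add: add.commute)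

text \<open>Here \<open>S_y i\<close> itself is invariant, and its bracket with \<open>S_x i\<close>
  times the monomial returns the monomial with factor \<open>-(d + 1)\<close>, where
  \<open>d\<close> is the exponent of \<open>S_x i\<close> in \<open>m\<close>.\<close>

lemma monomial_in_brackets_if_fixed_coordinate:
  assumes i: "\<And>e. e \<in> G \<Longrightarrow> e i = 1"
    and m: "\<And>e. e \<in> G \<Longrightarrow> exponent_sign e m = 1"
  shows "Poly_Mapping.single m 1 \<in> pm.span (S_brackets G)"
proof (rule pm.in_span_if_scaled)
  let ?g = "Poly_Mapping.single (m + Poly_Mapping.single (Inl i) 1) (1::complex)"
  have "?g \<in> invariants S_act G" "S_y i \<in> invariants S_act G"
    using i m by (auto simp: invariants_S_iff exponent_sign_add pvar_def)
  then have "poisson (S_y i) ?g \<in> pm.span (S_brackets G)"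
    by (intro pm.span_base) blast
  then show "scale (- (of_nat (Poly_Mapping.lookup m (Inl i)) + 1)) (Poly_Mapping.single m 1)
      \<in> pm.span (S_brackets G)"
    by (simp add: poisson_pvar partial_single lookup_add algebra_simps)
qed (simp only: neg_equal_0_iff_equal of_nat_plus_1_neq_0 not_False_eq_True)

text \<open>Replacing one factor \<open>v\<close> of the monomial by \<open>dual v\<close> keeps its
  sign. The bracket with the square of \<open>v\<close> undoes the replacement, up to a nonzero
  factor.\<close>

lemma nonconstant_monomial_in_brackets:
  assumes G: "G \<subseteq> carrier sign_vectors"
    and m: "\<And>e. e \<in> G \<Longrightarrow> exponent_sign e m = 1" and "m \<noteq> 0"
  shows "Poly_Mapping.single m 1 \<in> pm.span (S_brackets G)"
proof -
  obtain v where v: "Poly_Mapping.lookup m v \<noteq> 0"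
    using \<open>m \<noteq> 0\<close> by (metis lookup_zero poly_mapping_eqI)
  define k where "k = m - Poly_Mapping.single v 1"
  have m_eq: "m = k + Poly_Mapping.single v 1"
    unfolding k_def by (rule poly_mapping_eqI)
      (use v in \<open>auto simp: lookup_add lookup_minus lookup_single when_def\<close>)
  let ?g = "Poly_Mapping.single (k + Poly_Mapping.single (dual v) 1) (1::complex)"
  have "pvar v * pvar v = Poly_Mapping.single (Poly_Mapping.single v 1 + Poly_Mapping.single v 1) 1"
    by (simp add: pvar_def mult_single)
  then have "pvar v * pvar v \<in> invariants S_act G"
    using G var_sign_square[of _ v]
    by (auto simp: invariants_S_iff exponent_sign_add subset_iff simp flip: single_add)
  moreover have "?g \<in> invariants S_act G"
    using m by (auto simp: invariants_S_iff exponent_sign_add m_eq)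
  ultimately have "poisson (pvar v * pvar v) ?g \<in> pm.span (S_brackets G)"
    by (intro pm.span_base) blast
  moreover have "poisson (pvar v * pvar v) ?g =
      scale (2 * orientation v * (of_nat (Poly_Mapping.lookup k (dual v)) + 1)) (Poly_Mapping.single m 1)"
    unfolding poisson_pvar_square
    by (simp add: partial_single lookup_add pvar_def mult_single m_eq add.commute)
  ultimately show ?thesis
    by (metis (no_types, lifting) pm.in_span_if_scaled of_nat_plus_1_neq_0 orientation_neq_0
        mult_eq_0_iff zero_neq_numeral)
qed

section \<open>Constant terms of brackets\<close>

lemma lookup_mult_0:
  "Poly_Mapping.lookup (f * g) 0 = Poly_Mapping.lookup f 0 * Poly_Mapping.lookup g 0"
  for f g :: "'n poisson_alg"
proof (induction f rule: pm_induct)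
  case (single m c)
  show ?case
  proof (induction g rule: pm_induct)
    case (single k d)
    have "m + k = 0 \<longleftrightarrow> m = 0 \<and> k = 0"
      by (auto simp: poly_mapping_eq_iff lookup_add fun_eq_iff)
    then show ?case by (simp add: mult_single lookup_single when_def)
  qed (simp_all add: lookup_add algebra_simps)
qed (simp_all add: lookup_add algebra_simps)

lemma lookup_partial_0:
  "Poly_Mapping.lookup (partial v f) 0 = Poly_Mapping.lookup f (Poly_Mapping.single v 1)"
proof (induction f rule: pm_induct)
  case (single m c)
  \<comment> \<open>Subtraction of exponents is truncated and also sends \<open>m = 0\<close> to
    \<open>0\<close>; in that case the coefficient \<open>lookup m v\<close> vanishes.\<close>
  have "Poly_Mapping.lookup m v = 0 \<or> (m - Poly_Mapping.single v 1 = 0 \<longleftrightarrow> m = Poly_Mapping.single v 1)"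
    by (metis exponent_minus_plus add.left_neutral add_diff_cancel_right' diff_add_cancel
          add.right_neutral diff_self lookup_single_eq one_neq_zero cancel_comm_monoid_add_class.diff_cancel)
  then show ?case
    by (auto simp: partial_single lookup_single when_def)
qed (simp_all add: partial_add lookup_add)

text \<open>Every coordinate is moved, so invariants have no linear terms. The constant term of a
  bracket is built from linear coefficients of its arguments, hence vanishes.\<close>

lemma one_notin_brackets:
  fixes G :: "('n::finite \<Rightarrow> int) set"
  assumes "\<And>i. \<exists>e\<in>G. e i \<noteq> 1"
  shows "1 \<notin> pm.span (S_brackets G)"
proof -
  have "Poly_Mapping.lookup f (Poly_Mapping.single v 1) = 0" if "f \<in> invariants S_act G"
    for f and v :: "'n + 'n"
  proof (rule ccontr)
    assume "Poly_Mapping.lookup f (Poly_Mapping.single v 1) \<noteq> 0"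
    then have "\<forall>e\<in>G. var_sign e v = 1"
      using that unfolding invariants_S_iff by (metis exponent_sign_single power_one_right in_keys_iff)
    then show False using assms by (cases v) force+
  qed
  then have "S_brackets G \<subseteq> {h. Poly_Mapping.lookup h 0 = 0}"
    by (auto simp: poisson_def lookup_sum lookup_minus lookup_mult_0 lookup_partial_0)
  moreover have "pm.subspace {h. Poly_Mapping.lookup h (0 :: 'n + 'n \<Rightarrow>\<^sub>0 nat) = 0}"
    by (auto simp: pm.subspace_def lookup_add lookup_scale)
  ultimately have "pm.span (S_brackets G) \<subseteq> {h. Poly_Mapping.lookup h 0 = 0}"
    by (rule pm.span_minimal)
  then show ?thesis by auto
qed

section \<open>The Weyl symbol and the twisted trace\<close>

text \<open>\<open>moyal (1 / 2) v\<close> and \<open>moyal (- 1 / 2) v\<close> are the left and the right Moyal multiplication by \<open>v\<close>.\<close>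

definition moyal :: "complex \<Rightarrow> 'n + 'n \<Rightarrow> 'n poisson_alg \<Rightarrow> 'n poisson_alg" where
  "moyal s v g = pvar v * g + scale (s * orientation v) (partial (dual v) g)"

lemma moyal_add: "moyal s v (f + g) = moyal s v f + moyal s v g"
  by (simp add: moyal_def partial_add scale_add_right algebra_simps)

lemma moyal_scale: "moyal s v (scale c f) = scale c (moyal s v f)"
  by (simp add: moyal_def partial_scale scale_mult_right scale_add_right mult.commute)

lemma moyal_zero: "moyal s v 0 = 0"
  by (simp add: moyal_def)

lemma moyal_one: "moyal s v 1 = pvar v"
proof -
  have "partial u 1 = 0" for u :: "'a + 'a"
    using partial_single[of u 0 1] by simp
  then show ?thesis by (simp add: moyal_def)
qed

text \<open>With \<open>s = t = 1 / 2\<close> these are the Weyl relations; with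
  \<open>s = 1 / 2\<close> and \<open>t = - 1 / 2\<close> left and right multiplications
  commute.\<close>

lemma moyal_commutator:
  "moyal s u (moyal t v g) - moyal t v (moyal s u g) =
     (if v = dual u then scale ((s + t) * orientation u) g else 0)"
proof -
  have eq: "u = dual v \<longleftrightarrow> v = dual u" by auto
  \<comment> \<open>Up to commuting partial derivatives, everything but the last summand is
    symmetric under exchanging \<open>(s, u)\<close> with \<open>(t, v)\<close>, so only that
    summand contributes to the difference.\<close>
  have "moyal s u (moyal t v g) = pvar u * pvar v * g
      + scale (t * orientation v) (pvar u * partial (dual v) g)
      + scale (s * orientation u) (pvar v * partial (dual u) g)
      + scale (s * t * orientation u * orientation v) (partial (dual u) (partial (dual v) g))
      + (if v = dual u then scale (s * orientation u) g else 0)" for s t u v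
    by (simp add: moyal_def partial_add partial_mult partial_scale partial_pvar scale_mult_right
        scale_add_right distrib_left mult_ac)
  from this[of s u t v] this[of t v s u] show ?thesis
    using partial_commute[of "dual u" "dual v" g]
    by (auto simp: eq mult_ac scale_add_left distrib_right algebra_simps)
qed

text \<open>The representation of the free algebra by left Moyal multiplications;
  \<open>symbol_op a 1\<close> is the Weyl symbol of \<open>a\<close>.\<close>

definition symbol_op :: "('n + 'n) free_alg \<Rightarrow> 'n poisson_alg \<Rightarrow> 'n poisson_alg" where
  "symbol_op a g = lin_ext (\<lambda>w. foldr (moyal (1 / 2)) w g) a"

lemma foldr_moyal_add:
  "foldr (moyal s) w (f + g) = foldr (moyal s) w f + foldr (moyal s) w g"
  by (induction w) (simp_all add: moyal_add)

lemma foldr_moyal_scale: "foldr (moyal s) w (scale c f) = scale c (foldr (moyal s) w f)"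
  by (induction w) (simp_all add: moyal_scale)

lemma foldr_moyal_zero: "foldr (moyal s) w 0 = 0"
  by (induction w) (simp_all add: moyal_zero)

lemma symbol_op_add: "symbol_op (a + b) g = symbol_op a g + symbol_op b g"
  by (simp add: symbol_op_def lin_ext_add)

lemma symbol_op_diff: "symbol_op (a - b) g = symbol_op a g - symbol_op b g"
  by (simp add: symbol_op_def lin_ext_diff)

lemma symbol_op_scale: "symbol_op (scale c a) g = scale c (symbol_op a g)"
  by (simp add: symbol_op_def lin_ext_scale)

lemma symbol_op_zero [simp]: "symbol_op 0 g = 0" "symbol_op a 0 = 0"
  by (simp_all add: symbol_op_def foldr_moyal_zero lin_ext_def)

lemma symbol_op_one: "symbol_op 1 g = g"
  by (simp add: symbol_op_def zero_list_def flip: single_one)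

lemma symbol_op_fvar: "symbol_op (fvar v) g = moyal (1 / 2) v g"
  by (simp add: symbol_op_def fvar_def)

lemma symbol_op_mult: "symbol_op (a * b) g = symbol_op a (symbol_op b g)"
proof (induction a rule: pm_induct)
  case (single w c)
  show ?case
    by (induction b rule: pm_induct)
      (simp_all add: symbol_op_def lin_ext_add mult_single plus_list_def foldr_moyal_add
        foldr_moyal_scale foldr_moyal_zero scale_add_right distrib_left)
qed (simp_all add: symbol_op_add distrib_right)

lemma symbol_op_commutator:
  "symbol_op (commutator (fvar u) (fvar v)) g =
     (if v = dual u then scale (orientation u) g else 0)"
  using moyal_commutator[of "1 / 2" u "1 / 2" v g]
  by (simp add: commutator_def symbol_op_diff symbol_op_mult symbol_op_fvar)

lemma symbol_op_ideal: "a \<in> weyl_ideal \<Longrightarrow> symbol_op a g = 0"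
proof (induction arbitrary: g rule: weyl_ideal.induct)
  case (gen r a b)
  then have "symbol_op r h = 0" for h
    by (auto simp: weyl_relations_def symbol_op_diff symbol_op_commutator symbol_op_one)
  then show ?case by (simp add: symbol_op_mult)
qed (simp_all add: symbol_op_add)

lemma symbol_op_moyal_right: "symbol_op a (moyal (- 1 / 2) v g) = moyal (- 1 / 2) v (symbol_op a g)"
proof (induction a rule: pm_induct)
  case (single w c)
  have "foldr (moyal (1 / 2)) w (moyal (- 1 / 2) v g) = moyal (- 1 / 2) v (foldr (moyal (1 / 2)) w g)"
  proof (induction w)
    case (Cons u w)
    then show ?case
      using moyal_commutator[of "1 / 2" u "- 1 / 2" v "foldr (moyal (1 / 2)) w g"]
      by (simp split: if_splits)
  qed simp
  then show ?case by (simp add: symbol_op_def moyal_scale)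
qed (simp_all add: symbol_op_add moyal_add moyal_zero)

lemma lookup_moyal_0:
  "Poly_Mapping.lookup (moyal s v g) 0 =
     s * orientation v * Poly_Mapping.lookup g (Poly_Mapping.single (dual v) 1)"
proof -
  have "Poly_Mapping.single v 1 \<noteq> (0 :: 'a + 'a \<Rightarrow>\<^sub>0 nat)"
    by (metis lookup_single_eq lookup_zero one_neq_zero)
  then show ?thesis
    by (simp add: moyal_def lookup_add lookup_mult_0 lookup_scale lookup_partial_0)
      (simp add: pvar_def lookup_single when_def)
qed

text \<open>The functional \<tau>, well defined because the Weyl relations act as zero under
  \<open>symbol_op\<close>.\<close>

lift_definition weyl_trace :: "'n weyl \<Rightarrow> complex" is
  "\<lambda>a. Poly_Mapping.lookup (symbol_op a 1) 0"
  by (metis weyl_rel_def symbol_op_diff symbol_op_ideal eq_iff_diff_eq_0)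

lemma weyl_trace_add: "weyl_trace (a + b) = weyl_trace a + weyl_trace b"
  by transfer (simp add: symbol_op_add lookup_add)

lemma weyl_trace_scale: "weyl_trace (weyl_scale c a) = c * weyl_trace a"
  by transfer (simp add: symbol_op_scale lookup_scale)

lemma weyl_trace_uminus: "weyl_trace (- a) = - weyl_trace a"
  using weyl_trace_scale[of "- 1" a] by simp

lemma weyl_trace_diff: "weyl_trace (a - b) = weyl_trace a - weyl_trace b"
  using weyl_trace_add[of a "- b"] by (simp add: weyl_trace_uminus)

lemma weyl_trace_one [simp]: "weyl_trace 1 = 1"
  by transfer (simp add: symbol_op_one)

text \<open>Left and right Moyal multiplication by \<open>v\<close> differ in the sign of the
  derivative term, and the other term, \<open>pvar v * g\<close>, has no constant part.\<close>

lemma weyl_trace_var: "weyl_trace (weyl_var v * a) = - weyl_trace (a * weyl_var v)"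
proof transfer
  fix v :: "'n + 'n" and a
  \<comment> \<open>Both Moyal multiplications send \<open>1\<close> to \<open>pvar v\<close>, so
    the rightmost letter can be read as a right multiplication and pulled out past
    \<open>a\<close>.\<close>
  have "symbol_op (a * fvar v) 1 = moyal (- 1 / 2) v (symbol_op a 1)"
    by (simp only: symbol_op_mult symbol_op_fvar moyal_one symbol_op_moyal_right[symmetric])
  then show "Poly_Mapping.lookup (symbol_op (fvar v * a) 1) 0 =
      - Poly_Mapping.lookup (symbol_op (a * fvar v) 1) 0"
    by (simp only: symbol_op_mult symbol_op_fvar lookup_moyal_0) simp
qed

section \<open>Words in the Weyl generators\<close>

definition weyl_word :: "('n + 'n) list \<Rightarrow> 'n weyl" where
  "weyl_word w = prod_list (map weyl_var w)"

lemma weyl_word_Nil [simp]: "weyl_word [] = 1"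
  by (simp add: weyl_word_def)

lemma weyl_word_Cons: "weyl_word (v # w) = weyl_var v * weyl_word w"
  by (simp add: weyl_word_def)

lemma weyl_word_append: "weyl_word (u @ w) = weyl_word u * weyl_word w"
  by (simp add: weyl_word_def)

lemma weyl_trace_word:
  "weyl_trace (weyl_word w * a) = (- 1) ^ length w * weyl_trace (a * weyl_word w)"
proof (induction w arbitrary: a)
  case (Cons v w)
  have "weyl_trace (weyl_word (v # w) * a) = - weyl_trace (weyl_word w * (a * weyl_var v))"
    by (simp add: weyl_word_Cons weyl_trace_var mult.assoc)
  then show ?case by (simp add: Cons weyl_word_Cons mult.assoc)
qed simp

lemma abs_weyl_single: "abs_weyl (Poly_Mapping.single w c) = weyl_scale c (weyl_word w)"
proof -
  have "abs_weyl (Poly_Mapping.single w 1) = weyl_word w"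
  proof (induction w)
    case Nil
    then show ?case by (simp add: one_weyl.abs_eq zero_list_def flip: single_one)
  next
    case (Cons v w)
    have "Poly_Mapping.single (v # w) 1 = fvar v * Poly_Mapping.single w (1 :: complex)"
      by (simp add: fvar_def mult_single plus_list_def)
    then show ?case
      by (simp add: weyl_word_Cons weyl_var.abs_eq Cons[symmetric] times_weyl.abs_eq)
  qed
  then show ?thesis
    by (metis weyl_scale.abs_eq scale_single mult.right_neutral)
qed

lemma weyl_induct [case_names zero word add]:
  assumes "P 0" "\<And>c w. P (weyl_scale c (weyl_word w))" "\<And>a b. P a \<Longrightarrow> P b \<Longrightarrow> P (a + b)"
  shows "P a"
proof (induction a)
  case (1 f)
  show ?case
    by (induction f rule: pm_induct)
      (use assms in \<open>simp_all add: abs_weyl_single zero_weyl.abs_eq plus_weyl.abs_eq[symmetric]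
          flip: zero_weyl.abs_eq\<close>)
qed

lemma weyl_var_commutator:
  "weyl_var u * weyl_var v - weyl_var v * weyl_var u =
     (if v = dual u then weyl_scale (orientation u) 1 else 0)"
proof (cases u; cases v)
  fix i j assume "u = Inl i" "v = Inr j"
  then show ?thesis using weyl_p_q[of i j] by (auto simp: commutator_def)
next
  fix i j assume "u = Inr i" "v = Inl j"
  then show ?thesis using weyl_p_q[of j i] by (auto simp: commutator_def algebra_simps split: if_splits)
next
  fix i j assume "u = Inl i" "v = Inl j"
  then show ?thesis using weyl_p_p[of i j] by (auto simp: commutator_def)
next
  fix i j assume "u = Inr i" "v = Inr j"
  then show ?thesis using weyl_q_q[of i j] by (auto simp: commutator_def)
qed

section \<open>Invariants of the Weyl algebra modulo quadratic commutators\<close>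

definition word_sign :: "('n \<Rightarrow> int) \<Rightarrow> ('n + 'n) list \<Rightarrow> complex" where
  "word_sign e w = prod_list (map (var_sign e) w)"

lemma word_sign_simps [simp]:
  "word_sign e [] = 1" "word_sign e (v # w) = var_sign e v * word_sign e w"
  "word_sign e (u @ w) = word_sign e u * word_sign e w"
  by (simp_all add: word_sign_def)

lemma weyl_act_zero: "e \<in> carrier sign_vectors \<Longrightarrow> weyl_act e 0 = 0"
  using weyl_act_scale[of e 0 0] by simp

lemma weyl_act_diff:
  assumes "e \<in> carrier sign_vectors"
  shows "weyl_act e (a - b) = weyl_act e a - weyl_act e b"
  using weyl_act_add[OF assms, of "a - b" b] by (simp add: algebra_simps)

lemma weyl_act_word:
  assumes "e \<in> carrier sign_vectors"
  shows "weyl_act e (weyl_word w) = weyl_scale (word_sign e w) (weyl_word w)"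
  by (induction w)
    (simp_all add: assms weyl_act_one weyl_word_Cons weyl_act_mult weyl_act_var
      weyl_scale_mult_left weyl_scale_mult_right mult.commute)

definition invariant_word :: "('n \<Rightarrow> int) set \<Rightarrow> ('n + 'n) list \<Rightarrow> bool" where
  "invariant_word G w \<longleftrightarrow> (\<forall>e\<in>G. word_sign e w = 1)"

lemma weyl_word_invariant:
  assumes "G \<subseteq> carrier sign_vectors" "invariant_word G w"
  shows "weyl_word w \<in> invariants weyl_act G"
  using assms by (auto simp: invariants_def invariant_word_def weyl_act_word subset_iff)

lemma weyl_square_invariant:
  assumes "G \<subseteq> carrier sign_vectors"
  shows "weyl_var v * weyl_var v \<in> invariants weyl_act G"
proof -
  have "invariant_word G [v, v]"
    using assms by (auto simp: invariant_word_def var_sign_square)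
  then show ?thesis
    using weyl_word_invariant[OF assms] by (force simp: weyl_word_Cons)
qed

abbreviation quadratic_commutators :: "('n \<Rightarrow> int) set \<Rightarrow> 'n weyl set" where
  "quadratic_commutators G \<equiv>
     {commutator (weyl_var v * weyl_var v) a | v a. a \<in> invariants weyl_act G}"

section \<open>Reordering letters modulo shorter invariant words\<close>

context
  fixes G :: "('n \<Rightarrow> int) set" and T :: "'n weyl set" and k :: nat
  assumes G: "G \<subseteq> carrier sign_vectors"
    and T: "weyl.subspace T"
    and shorter: "\<And>w. invariant_word G w \<Longrightarrow> length w < k \<Longrightarrow> weyl_word w \<in> T"
begin

text \<open>The difference is zero unless the letters are conjugate. Then it is a multiple of a word
  two letters shorter, still invariant because conjugate letters have equal signs.\<close>

lemma swap_letters: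
  assumes "invariant_word G (u @ [a, b] @ z)" "length (u @ [a, b] @ z) \<le> k"
  shows "weyl_word (u @ [a, b] @ z) - weyl_word (u @ [b, a] @ z) \<in> T"
proof -
  have "weyl_word (u @ [a, b] @ z) - weyl_word (u @ [b, a] @ z) =
      weyl_word u * (weyl_var a * weyl_var b - weyl_var b * weyl_var a) * weyl_word z"
    by (simp add: weyl_word_append weyl_word_Cons mult.assoc right_diff_distrib left_diff_distrib)
  also have "\<dots> = (if b = dual a then weyl_scale (orientation a) (weyl_word (u @ z)) else 0)"
    unfolding weyl_var_commutator
    by (simp add: weyl_word_append weyl_scale_mult_left weyl_scale_mult_right)
  finally have eq: "weyl_word (u @ [a, b] @ z) - weyl_word (u @ [b, a] @ z) = \<dots>" .
  show ?thesis
  proof (cases "b = dual a")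
    case True
    have "word_sign e (u @ z) = word_sign e (u @ [a, b] @ z)" if "e \<in> G" for e
      using G that True var_sign_square[of e a] by (auto simp: mult.assoc[symmetric])
    then have "invariant_word G (u @ z)"
      using assms(1) unfolding invariant_word_def by (blast intro: trans)
    then show ?thesis
      unfolding eq using shorter[of "u @ z"] assms(2) True by (simp add: weyl.subspace_scale[OF T])
  next
    case False
    then show ?thesis unfolding eq by (simp add: weyl.subspace_0[OF T])
  qed
qed

lemma move_letter:
  assumes "invariant_word G (u @ v # w @ z)" "length (u @ v # w @ z) \<le> k"
  shows "weyl_word (u @ v # w @ z) - weyl_word (u @ w @ v # z) \<in> T"
  using assms
proof (induction w arbitrary: u)
  case Nil
  then show ?case by (simp add: weyl.subspace_0[OF T])
next
  case (Cons c w)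
  have "weyl_word (u @ [v, c] @ w @ z) - weyl_word (u @ [c, v] @ w @ z) \<in> T"
    using Cons.prems by (intro swap_letters) simp_all
  moreover have "weyl_word ((u @ [c]) @ v # w @ z) - weyl_word ((u @ [c]) @ w @ v # z) \<in> T"
    using Cons.prems by (intro Cons.IH) (simp_all add: invariant_word_def mult_ac)
  ultimately have "(weyl_word (u @ [v, c] @ w @ z) - weyl_word (u @ [c, v] @ w @ z)) +
     (weyl_word ((u @ [c]) @ v # w @ z) - weyl_word ((u @ [c]) @ w @ v # z)) \<in> T"
    by (rule weyl.subspace_add[OF T])
  then show ?case by simp
qed

text \<open>The Leibniz rule for \<open>[v, w]\<close>, up to reordering the letters: the term \<open>dual v\<close> replaces
  each letter that the commutator has removed.\<close>

lemma commutator_count: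
  assumes "invariant_word G (u @ w @ z)" "length (u @ w @ z) \<le> k"
  shows "weyl_word u * (weyl_var (dual v) * commutator (weyl_var v) (weyl_word w)) * weyl_word z
     - weyl_scale (orientation v * of_nat (count_list w (dual v))) (weyl_word (u @ w @ z)) \<in> T"
  using assms
proof (induction w arbitrary: u)
  case Nil
  then show ?case by (simp add: commutator_def weyl.subspace_0[OF T])
next
  case (Cons c w)
  let ?W = weyl_word and ?v = "weyl_var v" and ?d = "weyl_var (dual v)" and ?c = "weyl_var c"
  let ?D = "\<lambda>u w. ?W u * (?d * commutator ?v (?W w)) * ?W z"
  let ?E = "if c = v then weyl_scale (- orientation v) (?W (u @ v # w @ z) - ?W (u @ w @ v # z)) else 0"
  \<comment> \<open>After the Leibniz rule, \<open>dual v\<close> is moved past \<open>c\<close>.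
    The first summand counts \<open>c = dual v\<close>, the second survives only for
    \<open>c = v\<close> and is covered by \<open>move_letter\<close>, and the third is the
    induction hypothesis with \<open>c\<close> absorbed into \<open>u\<close>.\<close>
  have "?D u (c # w) = ?W u * ?d * (?v * ?c - ?c * ?v) * ?W w * ?W z
      + ?W u * (?d * ?c - ?c * ?d) * (?v * ?W w - ?W w * ?v) * ?W z + ?D (u @ [c]) w"
    by (simp add: commutator_def weyl_word_append weyl_word_Cons mult.assoc algebra_simps)
  also have "?W u * ?d * (?v * ?c - ?c * ?v) * ?W w * ?W z =
      weyl_scale (if c = dual v then orientation v else 0) (?W (u @ (c # w) @ z))"
    unfolding weyl_var_commutator
    by (simp add: weyl_scale_mult_left weyl_scale_mult_right weyl_word_append weyl_word_Cons mult.assoc)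
  also have "?W u * (?d * ?c - ?c * ?d) * (?v * ?W w - ?W w * ?v) * ?W z = ?E"
    unfolding weyl_var_commutator
    by (simp add: weyl_scale_mult_left weyl_scale_mult_right weyl_word_append weyl_word_Cons
        mult.assoc algebra_simps weyl.scale_right_diff_distrib)
  finally have eq: "?D u (c # w) - weyl_scale (orientation v * of_nat (count_list (c # w) (dual v)))
        (?W (u @ (c # w) @ z)) = ?E + (?D (u @ [c]) w
      - weyl_scale (orientation v * of_nat (count_list w (dual v))) (?W ((u @ [c]) @ w @ z)))"
    by (simp add: weyl.scale_left_distrib algebra_simps)
  have "?E \<in> T"
  proof (cases "c = v")
    case True
    then have "?W (u @ v # w @ z) - ?W (u @ w @ v # z) \<in> T"
      using Cons.prems by (intro move_letter) simp_all
    then show ?thesis using True by (simp only: refl if_True weyl.subspace_scale[OF T])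
  qed (simp add: weyl.subspace_0[OF T])
  moreover have "?D (u @ [c]) w
      - weyl_scale (orientation v * of_nat (count_list w (dual v))) (?W ((u @ [c]) @ w @ z)) \<in> T"
    using Cons.prems by (intro Cons.IH) simp_all
  ultimately show ?case unfolding eq by (rule weyl.subspace_add[OF T])
qed

text \<open>The analogue of the Poisson bracket with a square: the leading coefficient is the same,
  and the corrections from ordering lie in \<open>T\<close>.\<close>

lemma quadratic_commutator_reduces:
  assumes "invariant_word G (v # w)" "length (v # w) \<le> k"
  shows "commutator (weyl_var v * weyl_var v) (weyl_word (dual v # w))
    - weyl_scale (2 * orientation v * (of_nat (count_list w (dual v)) + 1)) (weyl_word (v # w)) \<in> T"
proof -
  let ?W = weyl_word and ?v = "weyl_var v" and ?d = "weyl_var (dual v)"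
  let ?n = "of_nat (count_list w (dual v)) :: complex" and ?o = "orientation v"
  let ?D = "?d * commutator ?v (?W w)"
  have inv: "invariant_word G (w @ [v])"
    using assms(1) by (simp add: invariant_word_def mult.commute)
  have vd: "?v * ?d = weyl_scale ?o 1 + ?d * ?v"
    using weyl_var_commutator[of v "dual v"] by (simp add: algebra_simps)
  have "commutator ?v (?W (dual v # w)) = (?v * ?d) * ?W w - ?d * ?W w * ?v"
    by (simp add: commutator_def weyl_word_Cons mult.assoc)
  also have "\<dots> = weyl_scale ?o (?W w) + ?D"
    unfolding vd by (simp add: commutator_def weyl_scale_mult_left algebra_simps)
  finally have X: "commutator ?v (?W (dual v # w)) = weyl_scale ?o (?W w) + ?D" .
  have "commutator (?v * ?v) (?W (dual v # w)) =
      ?v * commutator ?v (?W (dual v # w)) + commutator ?v (?W (dual v # w)) * ?v"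
    by (simp add: commutator_def algebra_simps)
  also have "\<dots> = weyl_scale ?o (?W (v # w)) + weyl_scale ?o (?W (w @ [v])) + ?v * ?D + ?D * ?v"
    unfolding X by (simp add: weyl_word_Cons weyl_word_append weyl_scale_mult_left
        weyl_scale_mult_right algebra_simps)
  finally have comm: "commutator (?v * ?v) (?W (dual v # w)) = \<dots>" .
  \<comment> \<open>Here \<open>a\<close>, \<open>b\<close> stand for \<open>?o\<close> times the
    words \<open>v # w\<close>, \<open>w @ [v]\<close>; \<open>c\<close>, \<open>d\<close> for
    \<open>?o * ?n\<close> times them; and \<open>p\<close>, \<open>q\<close> for
    \<open>?v * ?D\<close>, \<open>?D * ?v\<close>.\<close>
  have arith: "a + b + p + q - (a + (a + (c + c))) = (p - c) + (q - d) - ((a + c) - (b + d))"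
    for a b c d p q :: "'n weyl"
    by (simp add: algebra_simps)
  have coeff: "2 * ?o * (?n + 1) = ?o + (?o + (?o * ?n + ?o * ?n))"
    "?o * (?n + 1) = ?o + ?o * ?n"
    by (simp_all add: distrib_left)
  have "commutator (?v * ?v) (?W (dual v # w))
      - weyl_scale (2 * ?o * (?n + 1)) (?W (v # w)) =
      (?v * ?D - weyl_scale (?o * ?n) (?W (v # w)))
    + (?D * ?v - weyl_scale (?o * ?n) (?W (w @ [v])))
    - weyl_scale (?o * (?n + 1)) (?W (v # w) - ?W (w @ [v]))"
    unfolding comm coeff weyl.scale_right_diff_distrib weyl.scale_left_distrib by (rule arith)
  \<comment> \<open>Empty words are inserted so that \<open>commutator_count\<close> and
    \<open>move_letter\<close> match.\<close>
  also have "\<dots> =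
      (?W [v] * ?D * ?W [] - weyl_scale (?o * ?n) (?W ([v] @ w @ [])))
    + (?W [] * ?D * ?W [v] - weyl_scale (?o * ?n) (?W ([] @ w @ [v])))
    - weyl_scale (?o * (?n + 1)) (?W ([] @ v # w @ []) - ?W ([] @ w @ v # []))"
    by (simp add: weyl_word_Cons)
  also have "\<dots> \<in> T"
    using assms inv
    by (intro weyl.subspace_add[OF T] weyl.subspace_diff[OF T] weyl.subspace_scale[OF T]
        commutator_count move_letter) simp_all
  finally show ?thesis .
qed

end

text \<open>Induction on length, with \<open>T\<close> the span itself and
  \<open>k = length w\<close>: replacing the first letter by its conjugate gives a quadratic
  commutator that is a nonzero multiple of the word modulo \<open>T\<close>.\<close>

lemma invariant_word_reduces:
  assumes G: "G \<subseteq> carrier sign_vectors" and "invariant_word G w"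
  shows "weyl_word w \<in> weyl.span (insert 1 (quadratic_commutators G))"
  using assms(2)
proof (induction w rule: length_induct)
  case (1 w)
  let ?T = "weyl.span (insert 1 (quadratic_commutators G))"
  show ?case
  proof (cases w)
    case Nil
    then show ?thesis by (simp add: weyl.span_base)
  next
    case (Cons v u)
    let ?c = "2 * orientation v * (of_nat (count_list u (dual v)) + 1) :: complex"
    have "commutator (weyl_var v * weyl_var v) (weyl_word (dual v # u))
        - weyl_scale ?c (weyl_word w) \<in> ?T"
      unfolding Cons
      by (rule quadratic_commutator_reduces[OF G, where k = "length w"])
        (use 1 Cons in auto)
    moreover have "weyl_word (dual v # u) \<in> invariants weyl_act G"
      using 1 Cons by (intro weyl_word_invariant[OF G]) (simp add: invariant_word_def)
    then have "commutator (weyl_var v * weyl_var v) (weyl_word (dual v # u)) \<in> ?T"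
      by (intro weyl.span_base) blast
    ultimately have "weyl_scale ?c (weyl_word w) \<in> ?T"
      using weyl.span_diff by fastforce
    then show ?thesis
      by (rule weyl.in_span_if_scaled) simp
  qed
qed

section \<open>Characters of subgroups of \<open>{1, -1}\<^sup>n\<close>\<close>

lemma mult_sign_vectors: "e \<otimes>\<^bsub>sign_vectors\<^esub> f = (\<lambda>i. e i * f i)"
  by (simp add: sign_vectors_def sign_img_def fun_eq_iff)

lemma one_sign_vectors: "\<one>\<^bsub>sign_vectors\<^esub> = (\<lambda>_. 1)"
  by (simp add: sign_vectors_def sign_img_def fun_eq_iff)

lemma finite_sign_vectors: "finite (carrier (sign_vectors :: ('n::finite \<Rightarrow> int) monoid))"
  by (simp add: sign_vectors_def sign_img_def finite_PiE)

text \<open>Translation by some \<open>f\<close> with \<open>\<chi> f \<noteq> 1\<close> permutes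
  \<open>G\<close> and multiplies the sum by \<open>\<chi> f\<close>.\<close>

lemma sum_character_eq_0:
  fixes \<chi> :: "('n \<Rightarrow> int) \<Rightarrow> 'a::idom"
  assumes G: "subgroup G sign_vectors"
    and mult: "\<And>e f. \<chi> (\<lambda>i. e i * f i) = \<chi> e * \<chi> f"
    and "\<exists>e\<in>G. \<chi> e \<noteq> 1"
  shows "(\<Sum>e\<in>G. \<chi> e) = 0"
proof -
  obtain f where f: "f \<in> G" "\<chi> f \<noteq> 1" using assms(3) by blast
  have closed: "(\<lambda>i. f i * e i) \<in> G" if "e \<in> G" for e
    using subgroup.m_closed[OF G f(1) that] by (simp add: mult_sign_vectors)
  have "f \<in> carrier sign_vectors" using subgroup.subset[OF G] f(1) by blast
  then have "f i = 1 \<or> f i = - 1" for i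
    by (simp add: sign_vectors_iff)
  then have ff: "f i * (f i * x) = x" for i x
    by (metis minus_minus mult_1 mult_minus1)
  have "(\<Sum>e\<in>G. \<chi> e) = (\<Sum>e\<in>G. \<chi> (\<lambda>i. f i * e i))"
    by (intro sum.reindex_bij_witness[of _ "\<lambda>e i. f i * e i" "\<lambda>e i. f i * e i"])
      (simp_all only: closed ff)
  also have "\<dots> = \<chi> f * (\<Sum>e\<in>G. \<chi> e)"
    by (simp add: mult sum_distrib_left)
  finally show ?thesis using f(2) by (metis mult_cancel_right1)
qed

text \<open>Expanding products over subsets shows that the sum over \<open>e \<in> G\<close> of
  \<open>\<Prod>i. (1 + e\<^sub>i) - \<Prod>i. (1 - e\<^sub>i)\<close> is twice the sum of all character sums \<open>\<Sum>e\<in>G. \<Prod>i\<in>I. e\<^sub>i\<close> with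
  odd \<open>card I\<close>; only \<open>e = 1\<close> and \<open>e = -1\<close> contribute to it.\<close>

lemma odd_trivial_character:
  fixes G :: "('n::finite \<Rightarrow> int) set"
  assumes G: "subgroup G sign_vectors" and "(\<lambda>_. -1) \<notin> G"
  shows "\<exists>I. odd (card I) \<and> (\<forall>e\<in>G. (\<Prod>i\<in>I. e i) = 1)"
proof (rule ccontr)
  assume "\<not> ?thesis"
  then have vanish: "(\<Sum>e\<in>G. \<Prod>i\<in>I. e i) = 0" if "odd (card I)" for I
    using that by (intro sum_character_eq_0[OF G]) (auto simp: prod.distrib)
  have sub: "G \<subseteq> carrier sign_vectors" by (rule subgroup.subset[OF G])
  then have fin: "finite G" using finite_sign_vectors finite_subset by blast
  have pm: "e i = 1 \<or> e i = - 1" if "e \<in> G" for e i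
    using subsetD[OF sub that] by (simp add: sign_vectors_iff)
  have "(\<Sum>e\<in>G. \<Prod>i\<in>UNIV. - e i + 1) = (\<Sum>e\<in>G. \<Sum>I\<in>Pow UNIV. (\<Prod>i\<in>I. - e i) * (\<Prod>i\<in>UNIV - I. 1))"
    by (intro sum.cong prod_add refl finite)
  also have "\<dots> = (\<Sum>I\<in>UNIV. \<Sum>e\<in>G. \<Prod>i\<in>I. - e i)"
    by (subst sum.swap) simp
  also have "\<dots> = (\<Sum>I\<in>UNIV. (- 1) ^ card I * (\<Sum>e\<in>G. \<Prod>i\<in>I. e i))"
    by (simp add: prod_uminus sum_distrib_left)
  \<comment> \<open>The sign matters only for odd \<open>card I\<close>, where the character sum
    vanishes.\<close>
  also have "\<dots> = (\<Sum>I\<in>UNIV. \<Sum>e\<in>G. \<Prod>i\<in>I. e i)"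
    by (rule sum.cong) (auto simp: vanish uminus_power_if)
  also have "\<dots> = (\<Sum>e\<in>G. \<Sum>I\<in>Pow UNIV. (\<Prod>i\<in>I. e i) * (\<Prod>i\<in>UNIV - I. 1))"
    by (subst sum.swap) simp
  also have "\<dots> = (\<Sum>e\<in>G. \<Prod>i\<in>UNIV. e i + 1)"
    by (intro sum.cong prod_add[symmetric] refl finite)
  also have "\<dots> > 0"
  proof (rule sum_pos2[OF fin])
    show "(\<lambda>_. 1) \<in> G" using subgroup.one_closed[OF G] by (simp add: one_sign_vectors)
    show "0 \<le> (\<Prod>i\<in>UNIV. e i + 1)" if "e \<in> G" for e
    proof (rule prod_nonneg)
      show "0 \<le> e i + 1" for i using pm[OF that, of i] by auto
    qed
  qed simp
  finally have "(\<Sum>e\<in>G. \<Prod>i\<in>UNIV. - e i + 1) > 0" .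
  \<comment> \<open>An element other than \<open>-1\<close> has a coordinate \<open>1\<close>, which
    makes a factor zero. So the sum just shown to be positive is zero.\<close>
  moreover have "(\<Prod>i\<in>UNIV. - e i + 1) = 0" if "e \<in> G" for e
  proof -
    have "e \<noteq> (\<lambda>_. - 1)" using that assms(2) by blast
    then have "\<exists>i. e i \<noteq> - 1" by (simp add: fun_eq_iff)
    with pm[OF that] obtain i where "e i = 1" by blast
    then show ?thesis by (intro prod_zero) auto
  qed
  ultimately show False by simp
qed

lemma var_sign_mult: "var_sign (\<lambda>i. e i * f i) v = var_sign e v * var_sign f v"
  by (cases v) simp_all

lemma word_sign_mult: "word_sign (\<lambda>i. e i * f i) w = word_sign e w * word_sign f w"
  by (induction w) (simp_all add: var_sign_mult)

text \<open>Summing over \<open>G\<close> multiplies an invariant by \<open>card G\<close> and kills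
  every non-invariant word, leaving only invariant words to reduce.\<close>

lemma invariant_reduces:
  fixes G :: "('n::finite \<Rightarrow> int) set"
  assumes G: "subgroup G sign_vectors" and a: "a \<in> invariants weyl_act G"
  shows "a \<in> weyl.span (insert 1 (quadratic_commutators G))"
proof -
  let ?T = "weyl.span (insert 1 (quadratic_commutators G))"
  have sub: "G \<subseteq> carrier sign_vectors" by (rule subgroup.subset[OF G])
  then have "finite G" using finite_sign_vectors finite_subset by blast
  moreover have "G \<noteq> {}" using subgroup.one_closed[OF G] by blast
  ultimately have card: "complex_of_nat (card G) \<noteq> 0" by simp
  have act: "e \<in> carrier sign_vectors" if "e \<in> G" for e using sub that by blast
  have avg: "(\<Sum>e\<in>G. weyl_act e b) \<in> ?T" for b
  proof (induction b rule: weyl_induct)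
    case zero
    then show ?case by (simp add: weyl_act_zero act weyl.span_zero)
  next
    case (word c w)
    have "(\<Sum>e\<in>G. weyl_act e (weyl_scale c (weyl_word w))) =
        weyl_scale (c * (\<Sum>e\<in>G. word_sign e w)) (weyl_word w)"
      by (simp add: weyl_act_scale weyl_act_word act weyl.scale_sum_left sum_distrib_left)
    also have "\<dots> \<in> ?T"
    proof (cases "invariant_word G w")
      case True
      then show ?thesis by (intro weyl.span_scale invariant_word_reduces sub)
    next
      case False
      then have "(\<Sum>e\<in>G. word_sign e w) = 0"
        by (intro sum_character_eq_0[OF G] word_sign_mult) (simp add: invariant_word_def)
      then show ?thesis by (simp add: weyl.span_zero)
    qed
    finally show ?case .
  next
    case (add a b)
    then show ?case by (simp add: weyl_act_add act sum.distrib weyl.span_add)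
  qed
  have "(\<Sum>e\<in>G. weyl_act e a) = (\<Sum>e\<in>G. weyl_scale 1 a)"
    using a by (intro sum.cong) (auto simp: invariants_def)
  also have "\<dots> = weyl_scale (of_nat (card G)) a"
    by (simp only: weyl.scale_sum_left[symmetric] sum_constant mult.right_neutral)
  finally have "weyl_scale (of_nat (card G)) a \<in> ?T"
    using avg[of a] by simp
  then show ?thesis using card by (rule weyl.in_span_if_scaled)
qed

section \<open>The trace of commutators\<close>

text \<open>The sign \<open>(- 1) ^ length w\<close> in \<open>weyl_trace_word\<close> is the
  eigenvalue of \<open>-1\<close> on the word \<open>w\<close>.\<close>

lemma weyl_trace_twisted:
  fixes a b :: "'n weyl"
  shows "weyl_trace (a * b) = weyl_trace (b * weyl_act (\<lambda>_. - 1) a)"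
proof -
  have inv: "(\<lambda>_. - 1) \<in> carrier sign_vectors" by (simp add: sign_vectors_iff)
  have sign: "word_sign (\<lambda>_. - 1) w = (- 1) ^ length w" for w :: "('n + 'n) list"
  proof (induction w)
    case (Cons v w)
    then show ?case by (cases v) simp_all
  qed simp
  show ?thesis
    by (induction a rule: weyl_induct)
      (simp_all add: weyl_act_zero weyl_act_scale weyl_act_word weyl_act_add inv sign
        weyl_scale_mult_left weyl_scale_mult_right weyl_trace_scale weyl_trace_word weyl_trace_add
        distrib_left distrib_right)
qed

text \<open>Moving two letters cyclically costs two signs, which cancel.\<close>

lemma weyl_trace_quadratic_commutator:
  "weyl_trace (commutator (weyl_var v * weyl_var v) a) = 0"
  by (simp add: commutator_def weyl_trace_diff mult.assoc weyl_trace_var)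

lemma weyl_trace_kernel_subspace: "weyl.subspace {a. weyl_trace a = 0}"
  using weyl_trace_scale[of 0 0] by (auto simp: weyl.subspace_def weyl_trace_add weyl_trace_scale)

lemma weyl_var_commutes_word:
  assumes "dual v \<notin> set w"
  shows "weyl_var v * weyl_word w = weyl_word w * weyl_var v"
  using assms
proof (induction w)
  case (Cons u w)
  then have "weyl_var v * weyl_var u = weyl_var u * weyl_var v"
    using weyl_var_commutator[of v u] by auto
  then show ?case using Cons by (simp add: weyl_word_Cons) (metis mult.assoc)
qed simp

text \<open>For the outer pair \<open>p\<close>, \<open>q\<close> around \<open>Y\<close>,
  distinctness lets \<open>p\<close> commute with \<open>Y\<close>. Thus
  \<tau>(\<open>p Y q\<close>) equals \<tau>(\<open>Y q p\<close>) + \<tau>(\<open>Y\<close>), and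
  also -\<tau>(\<open>Y q p\<close>), so each pair contributes a factor
  \<open>1 / 2\<close>.\<close>

lemma weyl_trace_nested_pairs:
  assumes "distinct I"
  shows "weyl_trace (weyl_word (map Inl I @ map Inr (rev I))) = (1 / 2) ^ length I"
  using assms
proof (induction I)
  case (Cons i I)
  let ?Y = "weyl_word (map Inl I @ map Inr (rev I))"
  have "A_p i * ?Y = ?Y * A_p i"
    using Cons.prems by (intro weyl_var_commutes_word) auto
  then have Y: "A_p i * (?Y * A_q i) = ?Y * (A_p i * A_q i)"
    by (simp only: mult.assoc[symmetric])
  have pq: "A_p i * A_q i = A_q i * A_p i + 1"
    using weyl_p_q[of i i] by (simp add: commutator_def algebra_simps)
  have "weyl_trace (A_p i * (?Y * A_q i)) = weyl_trace (?Y * (A_q i * A_p i)) + weyl_trace ?Y"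
    (is "?t = ?x + ?y")
    unfolding Y pq by (simp add: distrib_left weyl_trace_add)
  moreover have "?t = - ?x"
    by (simp add: weyl_trace_var mult.assoc)
  ultimately have "?t + ?t = (?x + ?y) + - ?x"
    by (rule arg_cong2)
  then have "?t = ?y / 2"
    by (simp add: mult.commute)
  moreover have "weyl_word (map Inl (i # I) @ map Inr (rev (i # I))) = A_p i * (?Y * A_q i)"
    by (simp add: weyl_word_Cons weyl_word_append mult.assoc)
  ultimately show ?case using Cons by simp
qed simp

theorem mainTheorem6:
  fixes G :: "('n::finite \<Rightarrow> int) set"
  assumes "subgroup G sign_vectors"
  shows "(if \<exists>i. G \<subseteq> {e \<in> carrier sign_vectors. e i = 1} then has_dim (HP0 G) 0 else has_dim (HP0 G) 1)
       \<and> (if (\<lambda>_. -1) \<notin> G then has_dim (HH0 G) 0 else has_dim (HH0 G) 1)"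
proof -
  have G: "G \<subseteq> carrier sign_vectors" by (rule subgroup.subset[OF assms])
  have HP: "if \<exists>i. G \<subseteq> {e \<in> carrier sign_vectors. e i = 1} then has_dim (HP0 G) 0 else has_dim (HP0 G) 1"
  proof (cases "\<exists>i. G \<subseteq> {e \<in> carrier sign_vectors. e i = 1}")
    case True
    then obtain i where i: "e i = 1" if "e \<in> G" for e by blast
    have "has_dim (HP0 G) 0"
      unfolding HP0_def Let_def
    proof (rule has_dim_quotient_0[OF pm.vector_space_axioms invariants_S_subspace pm.subspace_span],
        rule subsetI, rule subspace_if_monomials[OF pm.subspace_span])
      fix f m assume "f \<in> invariants S_act G" "m \<in> Poly_Mapping.keys f"
      then show "Poly_Mapping.single m 1 \<in> pm.span (S_brackets G)"
        using i by (intro monomial_in_brackets_if_fixed_coordinate) (auto simp: invariants_S_iff)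
    qed
    with True show ?thesis by simp
  next
    case False
    then have moved: "\<exists>e\<in>G. e i \<noteq> 1" for i using G by blast
    have "has_dim (HP0 G) 1"
      unfolding HP0_def Let_def
    proof (rule has_dim_quotient_1[OF pm.vector_space_axioms invariants_S_subspace pm.subspace_span])
      show "1 \<in> invariants S_act G" by (simp add: invariants_def S_act_one)
      show "1 \<notin> pm.span (S_brackets G)" using moved by (rule one_notin_brackets)
      fix f assume f: "f \<in> invariants S_act G"
      have "f - scale (Poly_Mapping.lookup f 0) 1 \<in> pm.span (S_brackets G)"
      proof (rule subspace_if_monomials[OF pm.subspace_span])
        fix m assume "m \<in> Poly_Mapping.keys (f - scale (Poly_Mapping.lookup f 0) 1)"
        then have "m \<noteq> 0" "m \<in> Poly_Mapping.keys f"
          by (auto simp: in_keys_iff lookup_minus lookup_scale lookup_one when_def split: if_splits)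
        then show "Poly_Mapping.single m 1 \<in> pm.span (S_brackets G)"
          using f by (intro nonconstant_monomial_in_brackets[OF G]) (auto simp: invariants_S_iff)
      qed
      then show "\<exists>c. f - scale c 1 \<in> pm.span (S_brackets G)" by blast
    qed
    with False show ?thesis by simp
  qed
  let ?C = "{commutator a b | a b. a \<in> invariants weyl_act G \<and> b \<in> invariants weyl_act G}"
  have quad: "weyl.span (quadratic_commutators G) \<subseteq> weyl.span ?C"
    by (intro weyl.span_mono) (use weyl_square_invariant[OF G] in blast)
  have reduce: "\<exists>c. a - weyl_scale c 1 \<in> weyl.span (quadratic_commutators G)"
    if "a \<in> invariants weyl_act G" for a
    using invariant_reduces[OF assms that] by (simp add: weyl.span_insert)
  have HH: "if (\<lambda>_. -1) \<notin> G then has_dim (HH0 G) 0 else has_dim (HH0 G) 1"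
  proof (cases "(\<lambda>_. -1) \<in> G")
    case False
    then obtain I where I: "odd (card I)" "\<And>e. e \<in> G \<Longrightarrow> (\<Prod>i\<in>I. e i) = 1"
      using odd_trivial_character[OF assms] by blast
    obtain xs where xs: "set xs = I" "distinct xs"
      using finite_distinct_list[of I] by auto
    \<comment> \<open>The second list is reversed so that \<open>?a * ?b\<close> consists of nested
      pairs.\<close>
    let ?a = "weyl_word (map Inl xs)" and ?b = "weyl_word (map Inr (rev xs))"
    have sign: "word_sign e (map v ys) = (\<Prod>i\<in>I. of_int (e i))"
      if "set ys = I" "distinct ys" "\<And>i. var_sign e (v i) = of_int (e i)" for e v ys
      using that(1,2) by (simp add: word_sign_def that(3) comp_def prod.distinct_set_conv_list[symmetric])
    have inv: "?a \<in> invariants weyl_act G" "?b \<in> invariants weyl_act G"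
      using xs I(2)
      by (auto intro!: weyl_word_invariant[OF G] simp: invariant_word_def sign simp flip: of_int_prod)
    then have comm: "commutator ?a ?b \<in> ?C" by blast
    obtain c where c: "commutator ?a ?b - weyl_scale c 1 \<in> weyl.span (quadratic_commutators G)"
    proof -
      have "commutator ?a ?b \<in> invariants weyl_act G"
        using inv G unfolding invariants_def commutator_def
        by (auto simp: subset_iff weyl_act_mult weyl_act_diff)
      then show ?thesis using reduce that by blast
    qed
    \<comment> \<open>The trace kills quadratic commutators and is \<open>1\<close> on
      \<open>1\<close>, so it reads off \<open>c\<close>.\<close>
    have "weyl.span (quadratic_commutators G) \<subseteq> {a. weyl_trace a = 0}"
      by (intro weyl.span_minimal weyl_trace_kernel_subspace)
        (auto simp: weyl_trace_quadratic_commutator)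
    then have "weyl_trace (commutator ?a ?b) = c"
      using c by (auto simp: weyl_trace_diff weyl_trace_scale)
    \<comment> \<open>The word \<open>?b\<close> has odd length, so the two halves of the commutator
      add up instead of cancelling.\<close>
    moreover have "weyl_trace (?b * ?a) = - weyl_trace (?a * ?b)"
      using weyl_trace_word[of "map Inr (rev xs)" ?a] I(1) xs distinct_card[of xs] by simp
    then have "weyl_trace (commutator ?a ?b) = 2 * (1 / 2) ^ length xs"
      using weyl_trace_nested_pairs[OF xs(2)]
      by (simp add: commutator_def weyl_trace_diff weyl_word_append)
    ultimately have "c \<noteq> 0" by auto
    have "commutator ?a ?b - (commutator ?a ?b - weyl_scale c 1) \<in> weyl.span ?C"
      by (rule weyl.span_diff[OF weyl.span_base[OF comm] subsetD[OF quad c]])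
    then have "weyl_scale c 1 \<in> weyl.span ?C" by simp
    then have one: "1 \<in> weyl.span ?C" using \<open>c \<noteq> 0\<close> by (rule weyl.in_span_if_scaled)
    have "invariants weyl_act G \<subseteq> weyl.span ?C"
    proof
      fix a assume "a \<in> invariants weyl_act G"
      then obtain k where "a - weyl_scale k 1 \<in> weyl.span ?C" using reduce quad by blast
      then have "(a - weyl_scale k 1) + weyl_scale k 1 \<in> weyl.span ?C"
        using one by (intro weyl.span_add weyl.span_scale)
      then show "a \<in> weyl.span ?C" by simp
    qed
    then have "has_dim (HH0 G) 0"
      unfolding HH0_def Let_def
      by (intro has_dim_quotient_0 weyl.vector_space_axioms invariants_weyl_subspace[OF G]
          weyl.subspace_span)
    with False show ?thesis by simp
  next
    case True
    \<comment> \<open>Since \<open>-1\<close> lies in \<open>G\<close>, it fixes \<open>a\<close>,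
      and the twisted trace identity becomes an ordinary one.\<close>
    have "weyl_trace (commutator a b) = 0" if "a \<in> invariants weyl_act G" for a b
      using weyl_trace_twisted[of a b] that True
      by (simp add: commutator_def weyl_trace_diff invariants_def)
    then have "weyl.span ?C \<subseteq> {a. weyl_trace a = 0}"
      by (intro weyl.span_minimal weyl_trace_kernel_subspace) auto
    then have "1 \<notin> weyl.span ?C" by auto
    moreover have "1 \<in> invariants weyl_act G"
      using G by (auto simp: invariants_def weyl_act_one subset_iff)
    ultimately have "has_dim (HH0 G) 1"
      unfolding HH0_def Let_def using reduce quad
      by (intro has_dim_quotient_1[where u = 1] weyl.vector_space_axioms
          invariants_weyl_subspace[OF G] weyl.subspace_span) blast+
    with True show ?thesis by simp
  qed
  show ?thesis using HP HH by (rule conjI)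
qed

end
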